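(* Let $b \geq 3$ be an integer and let $D \subset \{0,1,\ldots,b-1\}$ with $2 \leq \#D \leq b-1$, such that $D$ contains at least one of $0$ and $b-1$. Let $C(b,D)$ be the corresponding generalized Cantor set, with Hausdorff dimension $\gamma = \log\#D/\log b$. Let $t \geq 2$ be an integer which is multiplicatively dependent with $b$ (i.e. $\log t/\log b \in \mathbb{Q}$). Let $f$ be a dimension function such that $r \mapsto r^{-\gamma} f(r)$ is monotonic, and let $\psi : \mathbb{N} \to (0,\infty)$ be any function. Then $$\mathcal{H}^{f} (W_{t}(\psi) \cap C(b,D)) = \begin{cases} 0, &\text{ if } \sum_{n=1}^{\infty} f(\psi(n))\, t^{n \gamma} < \infty, \\ \mathcal{H}^{f}(C(b,D)), &\text{ if } \sum_{n=1}^{\infty} f(\psi(n))\, t^{n \gamma} = \infty. \end{cases}$$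
   Context: The generalized Cantor set $C(b,D)$ is the set of real numbers $x \in [0,1]$ whose base-$b$ expansion uses only digits from $D$. A dimension function is a continuous, non-decreasing function $f:(0,\infty)\to(0,\infty)$ with $\lim_{r\to 0} f(r)=0$; $\mathcal{H}^f$ is the Hausdorff $f$-measure. For an integer $t\ge 2$ and $\psi:\mathbb{N}\to(0,\infty)$, $W_{t}(\psi) = \{x \in [0,1] : |x - p/t^n| < \psi(n) \text{ for infinitely many } (p,n) \in \mathbb{N}^2\}$. *)

theory Defs
  imports "HOL-Analysis.Analysis"
begin

definition dimension_function :: "(real \<Rightarrow> real) \<Rightarrow> bool" where
  "dimension_function f \<longleftrightarrow>
     continuous_on {0<..} f \<and> mono_on {0<..} f \<and> (\<forall>r>0. f r > 0) \<and>
     (f \<longlongrightarrow> 0) (at_right 0)"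

text \<open>Gauge value of a covering set: f(diam U), with the convention that a set of
  diameter 0 contributes 0 (f extended by f(0) = 0 = lim f).\<close>
definition gauge_val :: "(real \<Rightarrow> real) \<Rightarrow> real set \<Rightarrow> ennreal" where
  "gauge_val f U = (if diameter U = 0 then 0 else ennreal (f (diameter U)))"

definition hausdorff_pre :: "(real \<Rightarrow> real) \<Rightarrow> real \<Rightarrow> real set \<Rightarrow> ennreal" where
  "hausdorff_pre f \<delta> A =
     (INF U \<in> {U :: nat \<Rightarrow> real set. A \<subseteq> (\<Union>i. U i) \<and>
                 (\<forall>i. bounded (U i) \<and> diameter (U i) \<le> \<delta>)}.
        (\<Sum>i. gauge_val f (U i)))"

definition hausdorff_f_measure :: "(real \<Rightarrow> real) \<Rightarrow> real set \<Rightarrow> ennreal" where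
  "hausdorff_f_measure f A = (SUP \<delta> \<in> {0<..}. hausdorff_pre f \<delta> A)"

definition cantor_set :: "nat \<Rightarrow> nat set \<Rightarrow> real set" where
  "cantor_set b D = {x \<in> {0..1}. \<exists>d :: nat \<Rightarrow> nat. (\<forall>i. d i \<in> D) \<and>
       (\<lambda>i. real (d i) / real b ^ (Suc i)) sums x}"

definition W_set :: "nat \<Rightarrow> (nat \<Rightarrow> real) \<Rightarrow> real set" where
  "W_set t \<psi> = {x \<in> {0..1}. infinite {(p :: nat, n :: nat). n \<ge> 1 \<and>
       \<bar>x - real p / real t ^ n\<bar> < \<psi> n}}"

end

theory Submission
  imports Defs
begin

text \<open>Write \<open>t\<^sup>k = b\<^sup>l\<close> and \<open>q = card D\<close>, so that \<open>b powr \<gamma> = q\<close>. If the series converges, covering the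
  level-\<open>n\<close> part of the limsup set by intervals of length \<open>\<psi> n\<close> is enough. If it diverges, some
  residue class \<open>n = k * j + r\<close> already carries a divergent series, and there \<open>t\<^sup>n\<close> is a
  multiple of \<open>b\<^sup>m\<close> with \<open>m = l * j\<close>. Let \<open>z \<in> D\<close> be an extreme digit, 0 or \<open>b - 1\<close>: a point of
  the Cantor set whose digits equal \<open>z\<close> at the places \<open>m, \<dots>, m + s - 1\<close> lies within \<open>1 / b ^ (m + s)\<close>
  of a fraction with denominator \<open>b\<^sup>m\<close>. It therefore suffices to study digit sequences with
  infinitely many prescribed runs of \<open>z\<close>.

  If \<open>f r \<le> C * r powr \<gamma>\<close> near 0, the runs are almost independent, so by the second moment method
  the sequences without late runs are covered by an arbitrarily small proportion of the cylinders
  of some level, and those with finitely many runs form an \<open>f\<close>-null set. Otherwise \<open>r powr (-\<gamma>) * f r\<close> increases to infinity as \<open>r\<close> decreases to 0, and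
  the claim is that the sequences with infinitely many runs have infinite measure. Given a cover by
  cylinders with finite gauge sum, such a sequence is built outside it by descending through
  cylinders ending in a run, each chosen by averaging so that the part of the cover inside it has
  small gauge relative to the cylinder itself.\<close>

section \<open>Runs in digit sequences\<close>

locale digit_words =
  fixes D :: "nat set" and z :: nat
  assumes finite_D: "finite D" and z_mem: "z \<in> D" and card_ge2: "2 \<le> card D"
begin

abbreviation q :: real where "q \<equiv> real (card D)"

text \<open>Finite words are padded with \<open>z\<close>, so that a word and its extensions by copies of \<open>z\<close> are
  the same function. The digits at the places in \<open>X\<close> are prescribed by \<open>c\<close>.\<close>

definition words :: "nat \<Rightarrow> nat set \<Rightarrow> (nat \<Rightarrow> nat) \<Rightarrow> (nat \<Rightarrow> nat) set" where
  "words m X c = {x. (\<forall>i<m. x i \<in> (if i \<in> X then {c i} else D)) \<and> (\<forall>i\<ge>m. x i = z)}"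

lemma wordsI:
  assumes "\<And>i. i < m \<Longrightarrow> i \<in> X \<Longrightarrow> x i = c i" "\<And>i. i < m \<Longrightarrow> i \<notin> X \<Longrightarrow> x i \<in> D"
    "\<And>i. m \<le> i \<Longrightarrow> x i = z"
  shows "x \<in> words m X c"
  using assms by (simp add: words_def)

lemma words_fixed: "x \<in> words m X c \<Longrightarrow> i < m \<Longrightarrow> i \<in> X \<Longrightarrow> x i = c i"
  by (auto simp: words_def dest: spec[of _ i])

lemma words_pad: "x \<in> words m X c \<Longrightarrow> m \<le> i \<Longrightarrow> x i = z"
  by (auto simp: words_def)

lemma words_mem_D:
  assumes "x \<in> words m X c" "\<And>i. i \<in> X \<Longrightarrow> c i \<in> D"
  shows "x i \<in> D"
proof (cases "i < m")
  case True
  then have "x i \<in> (if i \<in> X then {c i} else D)" using assms(1) by (auto simp: words_def)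
  then show ?thesis using assms(2) by (auto split: if_splits)
qed (use words_pad[OF assms(1)] z_mem in auto)

lemma q_ge2: "2 \<le> q" using card_ge2 by simp

lemma bij_words:
  "bij_betw (\<lambda>x. restrict x {..<m}) (words m X c) (PiE {..<m} (\<lambda>i. if i \<in> X then {c i} else D))"
proof (rule bij_betw_byWitness[where f' = "\<lambda>y i. if i < m then y i else z"])
  show "\<forall>a\<in>words m X c. (\<lambda>i. if i < m then restrict a {..<m} i else z) = a"
    by (auto simp: words_def fun_eq_iff)
  show "\<forall>a'\<in>PiE {..<m} (\<lambda>i. if i \<in> X then {c i} else D).
      restrict (\<lambda>i. if i < m then a' i else z) {..<m} = a'"
    by (auto simp: fun_eq_iff PiE_def extensional_def)
  show "(\<lambda>x. restrict x {..<m}) ` words m X c \<subseteq> PiE {..<m} (\<lambda>i. if i \<in> X then {c i} else D)"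
    by (auto simp: words_def PiE_iff extensional_def restrict_def split: if_splits)
  show "(\<lambda>y i. if i < m then y i else z) ` PiE {..<m} (\<lambda>i. if i \<in> X then {c i} else D)
      \<subseteq> words m X c"
  proof (rule image_subsetI)
    fix y assume y: "y \<in> PiE {..<m} (\<lambda>i. if i \<in> X then {c i} else D)"
    have "y i \<in> (if i \<in> X then {c i} else D)" if "i < m" for i
      using PiE_mem[OF y] that by simp
    then show "(\<lambda>i. if i < m then y i else z) \<in> words m X c"
      unfolding words_def by simp
  qed
qed

lemma finite_words [simp]: "finite (words m X c)"
  using bij_betw_finite[OF bij_words] finite_D by (auto intro!: finite_PiE)

lemma card_words:
  assumes "X \<subseteq> {..<m}"
  shows "card (words m X c) = card D ^ (m - card X)"
proof -
  have "card (words m X c) = (\<Prod>i<m. card (if i \<in> X then {c i} else D))"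
    using bij_betw_same_card[OF bij_words] by (simp add: card_PiE)
  also have "\<dots> = (\<Prod>i<m. if i \<in> X then 1 else card D)"
    by (intro prod.cong) auto
  also have "\<dots> = (\<Prod>i\<in>{..<m} - X. card D)"
    using assms by (intro prod.mono_neutral_cong_right) auto
  also have "\<dots> = card D ^ (m - card X)"
    using assms by (simp add: card_Diff_subset finite_subset)
  finally show ?thesis .
qed

lemma card_words_real:
  assumes "X \<subseteq> {..<m}"
  shows "real (card (words m X c)) = q ^ m / q ^ card X"
proof -
  have "card X \<le> m" using card_mono[OF _ assms] by simp
  then show ?thesis using q_ge2
    by (subst card_words[OF assms]) (simp only: of_nat_power, rule power_diff, auto)
qed

lemma card_words_zero:
  assumes "X \<subseteq> {..<m}" "Y \<subseteq> {..<m}" "X \<inter> Y = {}"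
  shows "real (card {x \<in> words m Y c. \<forall>i\<in>X. x i = z}) = q ^ m / q ^ (card Y + card X)"
proof -
  have "x i \<in> (if i \<in> Y \<union> X then {if i \<in> Y then c i else z} else D) \<longleftrightarrow>
      x i \<in> (if i \<in> Y then {c i} else D) \<and> (i \<in> X \<longrightarrow> x i = z)" for x i
    using z_mem assms(3) by auto
  then have "{x \<in> words m Y c. \<forall>i\<in>X. x i = z} =
      words m (Y \<union> X) (\<lambda>i. if i \<in> Y then c i else z)"
    using assms(1) unfolding words_def by (simp only:) blast
  moreover have "card (Y \<union> X) = card Y + card X"
    using assms by (intro card_Un_disjoint) (auto intro: finite_subset)
  ultimately show ?thesis using card_words_real[of "Y \<union> X" m] assms by simp
qed

end

section \<open>Second moment estimate for the number of runs\<close>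

locale digit_runs = digit_words +
  fixes M s :: "nat \<Rightarrow> nat"
  assumes strict_M: "strict_mono M"
begin

definition run :: "nat \<Rightarrow> (nat \<Rightarrow> nat) \<Rightarrow> bool" where
  "run j x \<longleftrightarrow> (\<forall>i\<in>{M j..<M j + s j}. x i = z)"

lemma M_diff: "j \<le> j' \<Longrightarrow> j' - j \<le> M j' - M j"
proof (induction j' rule: dec_induct)
  case (step n)
  have "M n < M (Suc n)" using strict_M by (simp add: strict_mono_Suc_iff)
  moreover have "M j \<le> M n" using step strict_M by (simp add: strict_mono_less_eq)
  ultimately show ?case using step by linarith
qed simp

text \<open>Bounds the excess of the joint probability of two runs over the product of their
  probabilities, with \<open>j\<close> the earlier run. The ratio 1/2 stands in for 1/q, so that
  summing over \<open>j\<close> costs at most a factor 2.\<close>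

definition wt :: "nat \<Rightarrow> nat \<Rightarrow> real" where
  "wt j j' = (if j \<le> j' then (1/2) ^ (j' - j) / q ^ s j' else 0)"

lemma wt_nonneg: "0 \<le> wt j j'" by (simp add: wt_def)

text \<open>Runs at disjoint places are independent, and the product term alone suffices. If they
  overlap, together they prescribe the later run and all places from \<open>M j\<close> to
  \<open>M j'\<close>, which are at least \<open>j' - j\<close> further digits.\<close>

lemma run_pair_count_le:
  assumes "M j + s j \<le> n" "M j' + s j' \<le> n" "j \<le> j'"
  shows "real (card {x \<in> words n {} c. run j x \<and> run j' x})
     \<le> q ^ n * (1 / q ^ s j * (1 / q ^ s j') + wt j j')"
proof -
  let ?A = "{M j..<M j + s j}" and ?B = "{M j'..<M j' + s j'}"
  have mm: "M j \<le> M j'" using assms(3) strict_M by (simp add: strict_mono_less_eq)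
  have sub: "?A \<union> ?B \<subseteq> {..<n}" using assms by auto
  have eq: "real (card {x \<in> words n {} c. run j x \<and> run j' x}) = q ^ n / q ^ card (?A \<union> ?B)"
    using card_words_zero[OF sub, of "{}" c] by (simp add: run_def ball_Un)
  show ?thesis
  proof (cases "M j + s j \<le> M j'")
    case True
    then have "card (?A \<union> ?B) = s j + s j'" by (subst card_Un_disjoint) auto
    then show ?thesis unfolding eq using q_ge2 wt_nonneg[of j j']
      by (simp add: power_add distrib_left mult.commute)
  next
    case False
    have "(j' - j) + s j' \<le> (M j' - M j) + s j'" using M_diff[OF assms(3)] by simp
    also have "\<dots> = card ({M j..<M j'} \<union> ?B)" by (subst card_Un_disjoint) auto
    also have "\<dots> \<le> card (?A \<union> ?B)" using False by (intro card_mono) auto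
    finally have "q ^ ((j' - j) + s j') \<le> q ^ card (?A \<union> ?B)"
      using q_ge2 by (intro power_increasing) auto
    then have "q ^ n / q ^ card (?A \<union> ?B) \<le> q ^ n / q ^ ((j' - j) + s j')"
      using q_ge2 by (intro divide_left_mono) auto
    also have "\<dots> = q ^ n * (1 / q ^ s j') * (1 / q) ^ (j' - j)"
      by (simp add: power_add power_one_over field_simps)
    also have "\<dots> \<le> q ^ n * (1 / q ^ s j') * (1 / 2) ^ (j' - j)"
      using q_ge2 by (intro mult_left_mono power_mono) (auto simp: field_simps)
    also have "\<dots> = q ^ n * wt j j'" using assms(3) by (simp add: wt_def)
    also have "\<dots> \<le> q ^ n * (1 / q ^ s j * (1 / q ^ s j') + wt j j')"
      by (intro mult_left_mono) auto
    finally show ?thesis unfolding eq .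
  qed
qed

lemma sum_wt_le:
  assumes "finite F"
  shows "(\<Sum>j\<in>F. wt j j') \<le> 2 / q ^ s j'"
proof -
  have "(\<Sum>j\<in>F. wt j j') = (\<Sum>j\<in>{j\<in>F. j \<le> j'}. (1/2) ^ (j' - j) / q ^ s j')"
    using assms by (intro sum.mono_neutral_cong_right) (auto simp: wt_def)
  also have "\<dots> \<le> (\<Sum>j\<in>{..j'}. (1/2) ^ (j' - j) / q ^ s j')"
    by (intro sum_mono2) auto
  also have "\<dots> = (\<Sum>j\<in>{..j'}. (1/2) ^ (j' - j)) / q ^ s j'"
    by (simp add: sum_divide_distrib)
  also have "(\<Sum>j\<in>{..j'}. (1/2::real) ^ (j' - j)) = (\<Sum>i\<in>{..j'}. (1/2::real) ^ i)"
    by (rule sum.reindex_bij_witness[of _ "\<lambda>i. j' - i" "\<lambda>i. j' - i"]) auto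
  also have "\<dots> \<le> 2"
    by (subst sum_gp0) (auto simp: field_simps)
  finally show ?thesis using q_ge2 by (simp add: divide_right_mono)
qed

text \<open>Chebyshev's inequality for the number of runs in a uniformly random word: runs at distance
  \<open>d\<close> are correlated only by a factor \<open>q\<^sup>-\<^sup>d\<close>, so the variance is at most four times the mean.\<close>

lemma card_no_run_le:
  assumes F: "finite F" "\<And>j. j \<in> F \<Longrightarrow> M j + s j \<le> n"
  shows "real (card {x \<in> words n {} c. \<forall>j\<in>F. \<not> run j x}) * (\<Sum>j\<in>F. 1 / q ^ s j)
    \<le> 4 * q ^ n"
proof -
  let ?W = "words n {} c" and ?\<mu> = "\<Sum>j\<in>F. 1 / q ^ s j"
  let ?B = "{x \<in> ?W. \<forall>j\<in>F. \<not> run j x}"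
  let ?N = "\<lambda>x. \<Sum>j\<in>F. of_bool (run j x) :: real"
  have cW: "real (card ?W) = q ^ n" using card_words_real[of "{}" n c] by simp
  have \<mu>0: "0 \<le> ?\<mu>" by (intro sum_nonneg) auto
  have one: "(\<Sum>x\<in>?W. of_bool (run j x)) = q ^ n * (1 / q ^ s j)" if "j \<in> F" for j
  proof -
    have "(\<Sum>x\<in>?W. of_bool (run j x)) = real (card {x \<in> ?W. run j x})"
      by (simp add: Int_def conj_commute)
    also have "\<dots> = q ^ n / q ^ s j"
    proof -
      have sub: "{M j..<M j + s j} \<subseteq> {..<n}" using F(2)[OF that] by auto
      show ?thesis using card_words_zero[OF sub, of "{}" c] by (simp add: run_def)
    qed
    finally show ?thesis by simp
  qed
  \<comment> \<open>Both weights are included so that one bound serves either order of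
    \<open>j\<close> and \<open>j'\<close>; the weight in the wrong order is 0.\<close>
  have two: "(\<Sum>x\<in>?W. of_bool (run j x) * of_bool (run j' x))
     \<le> q ^ n * (1 / q ^ s j * (1 / q ^ s j') + wt j j' + wt j' j)" if "j \<in> F" "j' \<in> F" for j j'
  proof -
    have "(\<Sum>x\<in>?W. of_bool (run j x) * of_bool (run j' x)) =
        real (card {x \<in> ?W. run j x \<and> run j' x})"
      by (simp add: Int_def conj_commute flip: of_bool_conj)
    also have "\<dots> \<le> q ^ n * (1 / q ^ s j * (1 / q ^ s j') + wt j j' + wt j' j)"
    proof (cases "j \<le> j'")
      case True
      have "q ^ n * (1 / q ^ s j * (1 / q ^ s j') + wt j j')
        \<le> q ^ n * (1 / q ^ s j * (1 / q ^ s j') + wt j j' + wt j' j)"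
        using wt_nonneg by (intro mult_left_mono) auto
      then show ?thesis using run_pair_count_le[of j n j' c] True that F(2) by fastforce
    next
      case False
      have "q ^ n * (1 / q ^ s j' * (1 / q ^ s j) + wt j' j)
        \<le> q ^ n * (1 / q ^ s j * (1 / q ^ s j') + wt j j' + wt j' j)"
        using wt_nonneg by (intro mult_left_mono) (auto simp: mult.commute)
      moreover have "{x \<in> ?W. run j x \<and> run j' x} = {x \<in> ?W. run j' x \<and> run j x}" by auto
      ultimately show ?thesis using run_pair_count_le[of j' n j c] False that F(2) by fastforce
    qed
    finally show ?thesis .
  qed
  have mean: "(\<Sum>x\<in>?W. ?N x) = q ^ n * ?\<mu>"
    unfolding sum_distrib_left by (subst sum.swap) (intro sum.cong refl one)
  have wsum: "(\<Sum>j\<in>F. \<Sum>j'\<in>F. wt j' j) \<le> 2 * ?\<mu>"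
    using sum_mono[of F "\<lambda>j. \<Sum>j'\<in>F. wt j' j", OF sum_wt_le[OF F(1)]] by (simp add: sum_distrib_left)
  have wsum': "(\<Sum>j\<in>F. \<Sum>j'\<in>F. wt j j') \<le> 2 * ?\<mu>"
    using wsum by (subst sum.swap)
  have "(\<Sum>x\<in>?W. ?N x ^ 2) = (\<Sum>j\<in>F. \<Sum>j'\<in>F. \<Sum>x\<in>?W. of_bool (run j x) * of_bool (run j' x))"
    unfolding power2_eq_square sum_product
    by (subst sum.swap) (intro sum.cong refl sum.swap)
  also have "\<dots> \<le> (\<Sum>j\<in>F. \<Sum>j'\<in>F. q ^ n * (1 / q ^ s j * (1 / q ^ s j') + wt j j' + wt j' j))"
    by (intro sum_mono two)
  also have "\<dots> = q ^ n * (?\<mu> * ?\<mu> + (\<Sum>j\<in>F. \<Sum>j'\<in>F. wt j j') + (\<Sum>j\<in>F. \<Sum>j'\<in>F. wt j' j))"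
    by (simp only: sum_distrib_left[symmetric] sum.distrib sum_product)
  also have "\<dots> \<le> q ^ n * (?\<mu> * ?\<mu> + 2 * ?\<mu> + 2 * ?\<mu>)"
    using wsum wsum' \<mu>0 by (intro mult_left_mono add_mono) auto
  finally have sq: "(\<Sum>x\<in>?W. ?N x ^ 2) \<le> q ^ n * (?\<mu> * ?\<mu> + 4 * ?\<mu>)" by (simp add: algebra_simps)
  have sum_sq: "(\<Sum>x\<in>A. (g x - m)\<^sup>2) = (\<Sum>x\<in>A. g x ^ 2) - 2 * m * (\<Sum>x\<in>A. g x) + real (card A) * m\<^sup>2"
    for A :: "(nat \<Rightarrow> nat) set" and g and m :: real
    by (simp add: power2_diff sum.distrib sum_subtractf sum_distrib_left sum_distrib_right mult_ac)
  \<comment> \<open>The count \<open>?N\<close> vanishes on \<open>?B\<close>, so each word there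
    contributes the full square of the mean to the variance.\<close>
  have "real (card ?B) * ?\<mu>\<^sup>2 = (\<Sum>x\<in>?B. (?N x - ?\<mu>)\<^sup>2)"
    by simp
  also have "\<dots> \<le> (\<Sum>x\<in>?W. (?N x - ?\<mu>)\<^sup>2)"
    by (intro sum_mono2) auto
  also have "\<dots> = (\<Sum>x\<in>?W. ?N x ^ 2) - 2 * ?\<mu> * (\<Sum>x\<in>?W. ?N x) + real (card ?W) * ?\<mu>\<^sup>2"
    by (rule sum_sq)
  also have "\<dots> \<le> 4 * q ^ n * ?\<mu>"
    unfolding mean cW using sq by (simp add: power2_eq_square algebra_simps)
  finally have "real (card ?B) * ?\<mu> * ?\<mu> \<le> 4 * q ^ n * ?\<mu>" by (simp add: power2_eq_square)
  then show ?thesis using \<mu>0 by (cases "?\<mu> = 0") auto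
qed

end

text \<open>The sum is stopped as soon as it exceeds \<open>T\<close>; since terms are at most 1, it
  overshoots by at most 1.\<close>

lemma nonsummable_partial_sum:
  fixes p :: "nat \<Rightarrow> real"
  assumes p: "\<And>j. 0 \<le> p j" "\<And>j. p j \<le> 1" "\<not> summable p" and T: "0 \<le> T"
  obtains F where "finite F" "\<forall>j\<in>F. j0 \<le> j" "T \<le> (\<Sum>j\<in>F. p j)" "(\<Sum>j\<in>F. p j) \<le> T + 1"
proof -
  have "\<not> summable (\<lambda>i. p (i + j0))" using p(3) by (simp add: summable_iff_shift)
  then have "\<exists>n. T < (\<Sum>i<n. p (i + j0))"
    using summableI_nonneg_bounded[of "\<lambda>i. p (i + j0)" T] p(1) by (meson not_le)
  then obtain n where n: "T < (\<Sum>i<n. p (i + j0))" and least: "\<And>k. k < n \<Longrightarrow> \<not> T < (\<Sum>i<k. p (i + j0))"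
    using exists_least_iff[of "\<lambda>n. T < (\<Sum>i<n. p (i + j0))"] by auto
  obtain k where k: "n = Suc k" using n T by (cases n) auto
  have "(\<Sum>i<n. p (i + j0)) \<le> T + 1" using least[of k] p(2)[of "k + j0"] by (simp add: k)
  moreover have "(\<Sum>j\<in>(\<lambda>i. i + j0) ` {..<n}. p j) = (\<Sum>i<n. p (i + j0))"
    by (subst sum.reindex) (auto simp: inj_on_def)
  ultimately show thesis using n by (intro that[of "(\<lambda>i. i + j0) ` {..<n}"]) auto
qed

section \<open>Sequences with infinitely many runs outside a given cover\<close>

lemma sum_const_subsingleton:
  fixes c :: real
  assumes "\<And>x y. x \<in> A \<Longrightarrow> y \<in> A \<Longrightarrow> x = y" and "0 \<le> c" and "\<And>x. x \<in> A \<Longrightarrow> g x \<le> c"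
  shows "(\<Sum>x\<in>A. g x) \<le> c"
proof (cases "A = {}")
  case False
  then obtain x where "A = {x}" using assms(1) by blast
  then show ?thesis using assms(3) by simp
qed (use assms in simp)

definition agree :: "nat \<Rightarrow> (nat \<Rightarrow> 'a) \<Rightarrow> (nat \<Rightarrow> 'a) \<Rightarrow> bool" where
  "agree n x y \<longleftrightarrow> (\<forall>i<n. x i = y i)"

lemma agree_sym: "agree n x y \<longleftrightarrow> agree n y x" by (auto simp: agree_def)

lemma agree_mono: "agree n x y \<Longrightarrow> m \<le> n \<Longrightarrow> agree m x y" by (auto simp: agree_def)

lemma agree_trans: "agree n x y \<Longrightarrow> agree n y w \<Longrightarrow> agree n x w" by (auto simp: agree_def)

text \<open>Here \<open>h n\<close> models the gauge of a cylinder of length \<open>n\<close>, so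
  q^n * h n corresponds to r^(-\<gamma>) * f(r) at r = b^(-n); \<open>g_mono\<close> and
  \<open>g_unbounded\<close> say that it increases to infinity. Thanks to \<open>capped\<close>,
  finite families can be picked whose total lies in a prescribed interval of length 1.\<close>

locale run_gauge = digit_runs +
  fixes h :: "nat \<Rightarrow> real"
  assumes h_pos: "0 < h n"
    and h_anti: "n \<le> m \<Longrightarrow> h m \<le> h n"
    and g_mono: "n \<le> m \<Longrightarrow> q ^ n * h n \<le> q ^ m * h m"
    and g_unbounded: "\<exists>n. B < q ^ n * h n"
    and capped: "q ^ M j * h (M j + s j) \<le> 1"
    and divergent: "\<not> summable (\<lambda>j. q ^ M j * h (M j + s j))"
begin

abbreviation E :: "nat \<Rightarrow> nat" where "E j \<equiv> M j + s j"

text \<open>The pair \<open>(j, w)\<close> stands for the cylinder of length \<open>E j\<close> around \<open>w\<close>, a word of length \<open>M j\<close>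
  followed by a run. These cylinders are made disjoint by requiring a last digit different from \<open>z\<close>
  and by discarding the words that contain an earlier run of the family; as \<open>q\<^sup>n * h n\<close> is large
  at all levels involved, the latter discards few words.\<close>

lemma run_family:
  assumes vD: "\<And>i. v i \<in> D" and ga: "1 \<le> q ^ a * h a"
  obtains P :: "(nat \<times> (nat \<Rightarrow> nat)) set" where
    "finite P"
    "\<forall>j w. (j, w) \<in> P \<longrightarrow> a < M j \<and> (\<forall>i. w i \<in> D) \<and> agree a v w \<and> run j w"
    "2 * h a \<le> (\<Sum>(j, w)\<in>P. h (E j))"
    "\<forall>n\<ge>a. \<forall>c. (\<Sum>(j, w) | (j, w) \<in> P \<and> n \<le> E j \<and> agree n c w. h (E j)) \<le> 10 * h n"
    "\<forall>j w j' w' c. (j, w) \<in> P \<and> (j', w') \<in> P \<and> agree (E j) c w \<and> agree (E j') c w' \<longrightarrow>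
      (j, w) = (j', w')"
proof -
  let ?g = "\<lambda>n. q ^ n * h n" and ?p = "\<lambda>j. q ^ M j * h (E j)"
  \<comment> \<open>Only a quarter of the words survives in \<open>cardG\<close>, so 8 here leaves
    the factor 2 in the lower bound 2 * h a.\<close>
  define T where "T = 8 * ?g a"
  have q0: "0 < q" using q_ge2 by simp
  \<comment> \<open>A run has probability \<open>?p j / ?g (E j)\<close>. As the \<open>?p j\<close>
    add up to at most T + 1, taking all levels beyond \<open>N0\<close> makes the probabilities add
    up to at most 1/4.\<close>
  obtain N0 where N0: "4 * (T + 1) < ?g N0" using g_unbounded by blast
  have T8: "8 \<le> T" using ga by (simp add: T_def)
  have p01: "0 \<le> ?p j" "?p j \<le> 1" for j
    using capped[of j] h_pos[of "E j"] q0 by (simp_all add: less_imp_le)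
  have "0 \<le> T" using T8 by simp
  obtain F where F: "finite F" "\<forall>j\<in>F. max N0 (Suc a) \<le> j"
     "T \<le> (\<Sum>j\<in>F. ?p j)" "(\<Sum>j\<in>F. ?p j) \<le> T + 1"
    by (rule nonsummable_partial_sum[of ?p T "max N0 (Suc a)", OF p01 divergent \<open>0 \<le> T\<close>])
  have Mlarge: "N0 \<le> M j \<and> a < M j" if "j \<in> F" for j
    using bspec[OF F(2) that] strict_mono_imp_increasing[OF strict_M, of j] by auto
  have gE: "4 * (T + 1) < ?g (E j)" if "j \<in> F" for j
    using N0 g_mono[of N0 "E j"] Mlarge[OF that] by linarith
  have pE: "1 / q ^ s j = ?p j / ?g (E j)" if "j \<in> F" for j
    using q0 h_pos[of "E j"] by (simp add: power_add)
  have e_le: "1 / q ^ s j \<le> ?p j / (4 * (T + 1))" if "j \<in> F" for j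
    unfolding pE[OF that] using gE[OF that] T8 q0 h_pos[of "E j"]
    by (intro divide_left_mono) (auto intro!: mult_pos_pos)
  have e_sum: "(\<Sum>j\<in>F. 1 / q ^ s j) \<le> 1 / 4"
  proof -
    have "(\<Sum>j\<in>F. 1 / q ^ s j) \<le> (\<Sum>j\<in>F. ?p j / (4 * (T + 1)))"
      by (intro sum_mono e_le)
    also have "\<dots> = (\<Sum>j\<in>F. ?p j) / (4 * (T + 1))" by (simp add: sum_divide_distrib)
    also have "\<dots> \<le> (T + 1) / (4 * (T + 1))" using F(4) T8 by (intro divide_right_mono) auto
    also have "\<dots> = 1 / 4" using T8 by (simp add: field_simps)
    finally show ?thesis .
  qed
  have s_pos: "0 < s j" if "j \<in> F" for j
  proof (rule ccontr)
    assume "\<not> 0 < s j"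
    then have "1 \<le> (\<Sum>j\<in>F. 1 / q ^ s j)"
      using member_le_sum[OF that, of "\<lambda>j. 1 / q ^ s j"] F(1) by simp
    then show False using e_sum by simp
  qed
  define W where "W j = words (M j) {..<a} v" for j
  define G where "G j = {w \<in> W j. w (M j - 1) \<noteq> z \<and> (\<forall>j1\<in>F. E j1 \<le> M j \<longrightarrow> \<not> run j1 w)}" for j
  have WD: "w i \<in> D" if "w \<in> W j" for w i j
    using words_mem_D[OF that[unfolded W_def]] vD by simp
  have Wagree: "agree a v w" if "w \<in> W j" "j \<in> F" for w j
    using words_fixed[OF that(1)[unfolded W_def]] Mlarge[OF that(2)] by (auto simp: agree_def)
  have Wpad: "w i = z" if "w \<in> W j" "M j \<le> i" for w i j
    using words_pad that unfolding W_def by blast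
  have Wrun: "run j w" if "w \<in> W j" for w j
    using Wpad[OF that] by (auto simp: run_def)
  \<comment> \<open>Of the words extending \<open>v\<close>, at most half have last digit
    \<open>z\<close> and at most a quarter contain an earlier run of the family, so a quarter
    remains.\<close>
  have cardG: "q ^ M j / q ^ a / 4 \<le> real (card (G j))" if j: "j \<in> F" for j
  proof -
    let ?L = "{w \<in> W j. \<forall>i\<in>{M j - 1}. w i = z}"
    let ?R = "\<lambda>j1. {w \<in> W j. \<forall>i\<in>{M j1..<E j1}. w i = z}"
    let ?F = "{j1 \<in> F. E j1 \<le> M j}"
    have fin: "finite (W j)" by (simp add: W_def)
    have aM: "a < M j" using Mlarge[OF j] by simp
    have cW: "real (card (W j)) = q ^ M j / q ^ a"
      unfolding W_def using aM by (subst card_words_real) auto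
    have cL: "real (card ?L) \<le> q ^ M j / q ^ a / 2"
    proof -
      have "real (card ?L) = q ^ M j / q ^ (a + 1)"
        unfolding W_def using aM by (subst card_words_zero) auto
      also have "\<dots> = q ^ M j / q ^ a / q" by simp
      also have "\<dots> \<le> q ^ M j / q ^ a / 2" using q_ge2 by (intro divide_left_mono) auto
      finally show ?thesis .
    qed
    have cR: "real (card (?R j1)) = q ^ M j / q ^ a * (1 / q ^ s j1)" if "j1 \<in> ?F" for j1
      unfolding W_def using aM that Mlarge[of j1]
      by (subst card_words_zero) (auto simp: power_add)
    have "W j \<subseteq> G j \<union> (?L \<union> (\<Union>j1\<in>?F. ?R j1))" by (auto simp: G_def run_def)
    then have "card (W j) \<le> card (G j \<union> (?L \<union> (\<Union>j1\<in>?F. ?R j1)))"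
      using fin F(1) by (intro card_mono) (auto simp: G_def)
    also have "\<dots> \<le> card (G j) + (card ?L + (\<Sum>j1\<in>?F. card (?R j1)))"
      using card_UN_le[of ?F ?R] F(1)
      by (intro order_trans[OF card_Un_le] add_mono order_refl order_trans[OF card_Un_le]) auto
    finally have "real (card (W j)) \<le> real (card (G j) + (card ?L + (\<Sum>j1\<in>?F. card (?R j1))))"
      by (simp only: of_nat_le_iff)
    also have "\<dots> = real (card (G j)) + real (card ?L) + (\<Sum>j1\<in>?F. q ^ M j / q ^ a * (1 / q ^ s j1))"
      using cR by simp
    finally have "q ^ M j / q ^ a \<le> real (card (G j)) + real (card ?L)
        + (\<Sum>j1\<in>?F. q ^ M j / q ^ a * (1 / q ^ s j1))" unfolding cW .
    moreover have "(\<Sum>j1\<in>?F. q ^ M j / q ^ a * (1 / q ^ s j1)) \<le> q ^ M j / q ^ a * (1 / 4)"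
    proof -
      have "(\<Sum>j1\<in>?F. 1 / q ^ s j1) \<le> 1 / 4"
        by (rule order_trans[OF sum_mono2 e_sum]) (use F(1) q0 in auto)
      then show ?thesis unfolding sum_distrib_left[symmetric] using q0 by (intro mult_left_mono) auto
    qed
    moreover have "u \<le> x + y + S \<Longrightarrow> S \<le> u * (1 / 4) \<Longrightarrow> y \<le> u / 2 \<Longrightarrow> u / 4 \<le> x"
      for u x y S :: real by linarith
    ultimately show ?thesis using cL by blast
  qed
  define P where "P = Sigma F G"
  have finG: "finite (G j)" for j by (simp add: G_def W_def)
  have PF: "j \<in> F" "w \<in> G j" "w \<in> W j" if "(j, w) \<in> P" for j w
    using that by (auto simp: P_def G_def)
  have P_sum: "(\<Sum>(j, w)\<in>P. h (E j)) = (\<Sum>j\<in>F. real (card (G j)) * h (E j))"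
    unfolding P_def by (subst sum.Sigma[symmetric]) (auto simp: F finG)
  show thesis
  proof (rule that[of P]; (intro allI impI)?)
    show finP: "finite P" using F(1) finG by (auto simp: P_def)
    show "a < M j \<and> (\<forall>i. w i \<in> D) \<and> agree a v w \<and> run j w" if "(j, w) \<in> P" for j w
      using PF[OF that] Mlarge WD Wagree Wrun by blast
    have "2 * h a = T / (4 * q ^ a)" using q0 by (simp add: T_def)
    also have "\<dots> \<le> (\<Sum>j\<in>F. ?p j) / (4 * q ^ a)" using F(3) q0 by (intro divide_right_mono) auto
    also have "\<dots> = (\<Sum>j\<in>F. q ^ M j / q ^ a / 4 * h (E j))"
      by (simp add: sum_divide_distrib mult.commute)
    also have "\<dots> \<le> (\<Sum>j\<in>F. real (card (G j)) * h (E j))"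
      using h_pos by (intro sum_mono mult_right_mono cardG) (auto simp: less_imp_le)
    finally show "2 * h a \<le> (\<Sum>(j, w)\<in>P. h (E j))" unfolding P_sum .
    show "(\<Sum>(j, w) | (j, w) \<in> P \<and> n \<le> E j \<and> agree n c w. h (E j)) \<le> 10 * h n"
      if an: "a \<le> n" for n c
    proof -
      \<comment> \<open>Members whose run starts at \<open>n\<close> or later are bounded by
        counting all words that extend the first \<open>n\<close> digits of \<open>c\<close>: their
        total is at most (T + 1) / q^n, and T + 1 is at most 9 * ?g a. The members in
        \<open>?Q2\<close>, whose run starts before \<open>n\<close>, contribute the tenth
        \<open>h n\<close>, since there is at most one of them.\<close>
      let ?Q1 = "{(j, w). (j, w) \<in> P \<and> n \<le> M j \<and> agree n c w}"
      let ?Q2 = "{(j, w). (j, w) \<in> P \<and> M j < n \<and> n \<le> E j \<and> agree n c w}"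
      let ?S = "Sigma {j\<in>F. n \<le> M j} (\<lambda>j. words (M j) {..<n} c)"
      have "{(j, w). (j, w) \<in> P \<and> n \<le> E j \<and> agree n c w} = ?Q1 \<union> ?Q2" by auto
      moreover have "finite ?Q1" "finite ?Q2" by (auto intro: finite_subset[OF _ finP])
      ultimately have split: "(\<Sum>(j, w) | (j, w) \<in> P \<and> n \<le> E j \<and> agree n c w. h (E j)) =
          (\<Sum>(j, w)\<in>?Q1. h (E j)) + (\<Sum>(j, w)\<in>?Q2. h (E j))"
        by (simp only:) (rule sum.union_disjoint, auto)
      have "w \<in> words (M j) {..<n} c" if "(j, w) \<in> ?Q1" for j w
        using that PF[of j w] WD[of w j] Wpad[of w j] by (intro wordsI) (auto simp: agree_def)
      then have "?Q1 \<subseteq> ?S" using PF by auto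
      then have "(\<Sum>(j, w)\<in>?Q1. h (E j)) \<le> (\<Sum>(j, w)\<in>?S. h (E j))"
        using F(1) h_pos by (intro sum_mono2) (auto simp: less_imp_le)
      also have "\<dots> = (\<Sum>j | j \<in> F \<and> n \<le> M j. real (card (words (M j) {..<n} c)) * h (E j))"
        using F(1) by (subst sum.Sigma[symmetric]) auto
      also have "\<dots> = (\<Sum>j | j \<in> F \<and> n \<le> M j. ?p j / q ^ n)"
        by (intro sum.cong refl, subst card_words_real) auto
      also have "\<dots> \<le> (\<Sum>j\<in>F. ?p j / q ^ n)"
        using F(1) h_pos q0 by (intro sum_mono2) (auto simp: less_imp_le)
      also have "\<dots> = (\<Sum>j\<in>F. ?p j) / q ^ n" by (simp add: sum_divide_distrib)
      also have "\<dots> \<le> (9 * ?g n) / q ^ n"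
        using F(4) g_mono[OF an] ga q0 by (intro divide_right_mono) (auto simp: T_def)
      also have "\<dots> = 9 * h n" using q0 by simp
      finally have Q1: "(\<Sum>(j, w)\<in>?Q1. h (E j)) \<le> 9 * h n" .
      have Q2D: "(j, w) \<in> P" "M j < n" "agree n c w" if "(j, w) \<in> ?Q2" for j w
        using that by auto
      \<comment> \<open>The last digit of \<open>w'\<close> sits at a place below \<open>n\<close>
        where \<open>w\<close> is already in its run of \<open>z\<close>; as both words follow
        \<open>c\<close> there, that digit would be \<open>z\<close>.\<close>
      have neq: False if "(j, w) \<in> ?Q2" "(j', w') \<in> ?Q2" "j < j'" for j w j' w'
      proof -
        note Q = Q2D[OF that(1)] and Q' = Q2D[OF that(2)]
        have less: "M j < M j'" using that(3) strict_M by (simp add: strict_mono_less)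
        have "w (M j' - 1) = z" using Wpad[OF PF(3)[OF Q(1)], of "M j' - 1"] less by linarith
        moreover have "w (M j' - 1) = w' (M j' - 1)"
          using Q(3) Q'(2,3) unfolding agree_def by (metis less_imp_diff_less)
        ultimately show False using PF(2)[OF Q'(1)] by (simp add: G_def)
      qed
      have Q2: "(\<Sum>(j, w)\<in>?Q2. h (E j)) \<le> h n"
      proof (rule sum_const_subsingleton)
        fix x y assume xy: "x \<in> ?Q2" "y \<in> ?Q2"
        obtain j w j' w' where eq: "x = (j, w)" "y = (j', w')" by (metis surj_pair)
        note Q = Q2D[OF xy(1)[unfolded eq(1)]] and Q' = Q2D[OF xy(2)[unfolded eq(2)]]
        have "\<not> j < j'" "\<not> j' < j" using neq[OF xy[unfolded eq]] neq[OF xy(2,1)[unfolded eq]] by blast+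
        then have "j = j'" by simp
        moreover have "w i = w' i" for i
          using Wpad[OF PF(3)[OF Q(1)], of i] Wpad[OF PF(3)[OF Q'(1)], of i] Q(2,3) Q'(3)
            \<open>j = j'\<close> by (cases "i < n") (auto simp: agree_def)
        ultimately show "x = y" unfolding eq by auto
      next
        show "(case x of (j, w) \<Rightarrow> h (E j)) \<le> h n" if "x \<in> ?Q2" for x
          using that by (auto intro: h_anti)
      qed (use h_pos in \<open>simp add: less_imp_le\<close>)
      show ?thesis unfolding split using Q1 Q2 by simp
    qed
    show "(j, w) = (j', w')"
      if *: "(j, w) \<in> P \<and> (j', w') \<in> P \<and> agree (E j) c w \<and> agree (E j') c w'" for j w j' w' c
    proof -
      from * have PP: "(j, w) \<in> P" "(j', w') \<in> P" and ag: "agree (E j) c w" "agree (E j') c w'"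
        by auto
      have main: "(j, w) = (j', w')"
        if PP: "(j, w) \<in> P" "(j', w') \<in> P" and ag: "agree (E j) c w" "agree (E j') c w'"
          and le: "E j \<le> E j'" for j w j' w'
      proof -
        have ag': "w i = w' i" if "i < E j" for i
          using ag le that by (auto simp: agree_def)
        note PF1 = PF[OF PP(1)] and PF2 = PF[OF PP(2)]
        \<comment> \<open>For different indices, either the later word contains the complete earlier
          run, or its last digit falls inside that run and equals \<open>z\<close>. Both are
          excluded in \<open>G\<close>.\<close>
        consider "j < j'" | "j' < j" | "j = j'" by linarith
        then show ?thesis
        proof cases
          case 1
          then have mm: "M j < M j'" using strict_M by (simp add: strict_mono_less)
          show ?thesis
          proof (cases "E j \<le> M j'")
            case True
            have "run j w'" using Wrun[OF PF1(3)] ag' by (auto simp: run_def)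
            then show ?thesis using PF1(1) PF2(2) True by (auto simp: G_def)
          next
            case False
            then have "w' (M j' - 1) = z"
              using Wpad[OF PF1(3), of "M j' - 1"] ag'[of "M j' - 1"] mm by auto
            then show ?thesis using PF2(2) by (auto simp: G_def)
          qed
        next
          case 2
          then have mm: "M j' < M j" using strict_M by (simp add: strict_mono_less)
          then have "w (M j - 1) = z"
            using Wpad[OF PF2(3), of "M j - 1"] ag'[of "M j - 1"] by auto
          then show ?thesis using PF1(2) by (auto simp: G_def)
        next
          case 3
          have "w i = w' i" for i
            using ag'[of i] Wpad[OF PF1(3), of i] Wpad[OF PF2(3), of i] 3
            by (cases "i < M j") auto
          then show ?thesis using 3 by auto
        qed
      qed
      show ?thesis using main[OF PP ag] main[OF PP(2,1) ag(2,1)] nat_le_linear[of "E j" "E j'"] by auto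
    qed
  qed
qed

text \<open>The sequences \<open>N\<close>, \<open>c\<close> describe a cover by cylinders: its \<open>i\<close>-th element consists of the
  sequences agreeing with \<open>c i\<close> at the first \<open>N i\<close> places. Below, \<open>residue\<close> is the gauge sum of the
  elements properly inside the cylinder of length \<open>n\<close> around \<open>v\<close>, and \<open>hit\<close> means that some
  element contains that cylinder.\<close>

definition residue :: "(nat \<Rightarrow> nat) \<Rightarrow> (nat \<Rightarrow> nat \<Rightarrow> nat) \<Rightarrow> nat \<Rightarrow> (nat \<Rightarrow> nat) \<Rightarrow> real" where
  "residue N c n v = (\<Sum>i. if n < N i \<and> agree n (c i) v then h (N i) else 0)"

definition hit :: "(nat \<Rightarrow> nat) \<Rightarrow> (nat \<Rightarrow> nat \<Rightarrow> nat) \<Rightarrow> nat \<Rightarrow> (nat \<Rightarrow> nat) \<Rightarrow> bool" where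
  "hit N c n v \<longleftrightarrow> (\<exists>i. N i \<le> n \<and> agree (N i) (c i) v)"

lemma summable_filter:
  assumes "summable (\<lambda>i. h (N i))" "\<And>i. Q i \<Longrightarrow> b i \<le> h (N i)" "\<And>i. 0 \<le> b i"
  shows "summable (\<lambda>i. if Q i then b i else 0)"
  by (rule summable_comparison_test'[OF assms(1)]) (use assms h_pos in \<open>auto simp: less_imp_le\<close>)

text \<open>Averaging over the cylinders of \<open>run_family\<close>: those that are hit have small total gauge, and
  the residues of the others add up to at most the residue of \<open>v\<close>.\<close>

lemma run_step:
  assumes vD: "\<And>i. v i \<in> D" and ga: "1 \<le> q ^ a * h a"
    and N: "summable (\<lambda>i. h (N i))"
    and hit: "\<not> hit N c a v" and res: "residue N c a v < h a / 10"
  obtains j w where "a < M j" "\<forall>i. w i \<in> D" "agree a v w" "run j w" "\<not> hit N c (E j) w"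
    "residue N c (E j) w < h (E j) / 10"
proof -
  obtain P where P0: "finite P"
    "\<forall>j w. (j, w) \<in> P \<longrightarrow> a < M j \<and> (\<forall>i. w i \<in> D) \<and> agree a v w \<and> run j w"
    "2 * h a \<le> (\<Sum>(j, w)\<in>P. h (E j))"
    "\<forall>n\<ge>a. \<forall>c. (\<Sum>(j, w) | (j, w) \<in> P \<and> n \<le> E j \<and> agree n c w. h (E j)) \<le> 10 * h n"
    "\<forall>j w j' w' c. (j, w) \<in> P \<and> (j', w') \<in> P \<and> agree (E j) c w \<and> agree (E j') c w' \<longrightarrow>
      (j, w) = (j', w')"
    by (rule run_family[of v a, OF vD ga])
  note P = P0(1) P0(2)[rule_format] P0(3) P0(4)[rule_format] P0(5)[rule_format]
  define K where "K = {(j, w). (j, w) \<in> P \<and> hit N c (E j) w}"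
  define S where "S = {(j, w). (j, w) \<in> P \<and> \<not> hit N c (E j) w}"
  have KS: "P = K \<union> S" "K \<inter> S = {}" by (auto simp: K_def S_def)
  have fin: "finite K" "finite S" using P(1) KS by auto
  let ?in = "\<lambda>i. a < N i \<and> agree a (c i) v"
  let ?k = "\<lambda>i p. N i \<le> E (fst p) \<and> agree (N i) (c i) (snd p)"
  have sum_in: "summable (\<lambda>i. if ?in i then h (N i) else 0)"
    by (rule summable_filter[OF N]) (use h_pos in \<open>auto simp: less_imp_le\<close>)
  have sum_k: "summable (\<lambda>i. if ?in i \<and> ?k i p then h (E (fst p)) else 0)" for p
    by (rule summable_filter[OF N]) (use h_pos h_anti in \<open>auto simp: less_imp_le\<close>)
  have below: "agree a (c i) v" if "(j, w) \<in> P" "agree n (c i) w" "a \<le> n" for i j w n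
    using that P(2)[of j w] by (auto simp: agree_def)
  \<comment> \<open>Each hit cylinder is charged to a cover element containing it. That element lies
    properly inside the cylinder of \<open>v\<close>, because the latter is not hit, and so it is
    counted in the residue of \<open>v\<close>.\<close>
  have Kbound: "h (E (fst p)) \<le> (\<Sum>i. if ?in i \<and> ?k i p then h (E (fst p)) else 0)" if pK: "p \<in> K" for p
  proof -
    obtain j w where p: "p = (j, w)" by (cases p)
    obtain i where i: "N i \<le> E j" "agree (N i) (c i) w" and PP: "(j, w) \<in> P"
      using pK p unfolding K_def hit_def by auto
    have "a < N i"
    proof (rule ccontr)
      assume "\<not> a < N i"
      then have "hit N c a v"
        using i P(2)[OF PP] unfolding hit_def agree_def by (metis not_less order_less_le_trans)
      then show False using hit by simp
    qed
    then have "?in i \<and> ?k i p" using below[OF PP i(2)] i p by auto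
    then have "h (E (fst p)) = (if ?in i \<and> ?k i p then h (E (fst p)) else 0)" by simp
    also have "\<dots> = (\<Sum>i\<in>{i}. if ?in i \<and> ?k i p then h (E (fst p)) else 0)" by simp
    also have "\<dots> \<le> (\<Sum>i. if ?in i \<and> ?k i p then h (E (fst p)) else 0)"
      by (rule sum_le_suminf[OF sum_k]) (use h_pos in \<open>auto simp: less_imp_le\<close>)
    finally show ?thesis .
  qed
  have "(\<Sum>(j, w)\<in>K. h (E j)) = (\<Sum>p\<in>K. h (E (fst p)))" by (simp add: case_prod_unfold)
  also have "\<dots> \<le> (\<Sum>p\<in>K. \<Sum>i. if ?in i \<and> ?k i p then h (E (fst p)) else 0)"
    by (intro sum_mono Kbound)
  also have "\<dots> = (\<Sum>i. \<Sum>p\<in>K. if ?in i \<and> ?k i p then h (E (fst p)) else 0)"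
    by (rule suminf_sum[symmetric]) (rule sum_k)
  \<comment> \<open>After exchanging the sums, the members charged to one element lie inside it, so
    the fourth property of the family bounds their total by ten times its gauge.\<close>
  also have "\<dots> \<le> (\<Sum>i. 10 * (if ?in i then h (N i) else 0))"
  proof (rule suminf_le)
    show "summable (\<lambda>i. \<Sum>p\<in>K. if ?in i \<and> ?k i p then h (E (fst p)) else 0)"
      by (rule summable_sum) (rule sum_k)
    show "summable (\<lambda>i. 10 * (if ?in i then h (N i) else 0))"
      by (rule summable_mult[OF sum_in])
    fix i
    show "(\<Sum>p\<in>K. if ?in i \<and> ?k i p then h (E (fst p)) else 0) \<le> 10 * (if ?in i then h (N i) else 0)"
    proof (cases "?in i")
      case True
      then have "(\<Sum>p\<in>K. if ?in i \<and> ?k i p then h (E (fst p)) else 0) =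
          (\<Sum>p\<in>K. if ?k i p then h (E (fst p)) else 0)" by simp
      also have "\<dots> = (\<Sum>p | p \<in> K \<and> ?k i p. h (E (fst p)))"
        using fin by (simp add: sum.inter_filter)
      also have "\<dots> \<le> (\<Sum>(j, w) | (j, w) \<in> P \<and> N i \<le> E j \<and> agree (N i) (c i) w. h (E j))"
        unfolding case_prod_unfold
        by (rule sum_mono2)
           (use P(1) h_pos in \<open>auto simp: less_imp_le K_def intro: finite_subset[OF _ P(1)]\<close>)
      also have "\<dots> \<le> 10 * h (N i)" using P(4) True by simp
      finally show ?thesis using True by simp
    next
      case False
      then have L: "(\<Sum>p\<in>K. if ?in i \<and> ?k i p then h (E (fst p)) else 0) = 0"
        by (intro sum.neutral) auto
      show ?thesis by (simp only: L if_not_P[OF False] mult_zero_right order_refl)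
    qed
  qed
  also have "\<dots> = 10 * residue N c a v"
    unfolding residue_def by (rule suminf_mult[OF sum_in])
  \<comment> \<open>The family has total at least 2 * h a, so more than \<open>h a\<close> is left
    for the members that are not hit.\<close>
  finally have "(\<Sum>(j, w)\<in>K. h (E j)) < h a" using res by simp
  moreover have "(\<Sum>(j, w)\<in>P. h (E j)) = (\<Sum>(j, w)\<in>K. h (E j)) + (\<Sum>(j, w)\<in>S. h (E j))"
    unfolding KS(1) using fin KS(2) by (rule sum.union_disjoint)
  ultimately have S_large: "h a < (\<Sum>(j, w)\<in>S. h (E j))" using P(3) by simp
  let ?r = "\<lambda>i p. if E (fst p) < N i \<and> agree (E (fst p)) (c i) (snd p) then h (N i) else 0"
  have sum_r: "summable (\<lambda>i. ?r i p)" for p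
    by (rule summable_filter[OF N]) (use h_pos in \<open>auto simp: less_imp_le\<close>)
  have "\<exists>(j, w)\<in>S. residue N c (E j) w < h (E j) / 10"
  proof (rule ccontr)
    assume "\<not> ?thesis"
    then have "(\<Sum>p\<in>S. h (E (fst p)) / 10) \<le> (\<Sum>p\<in>S. residue N c (E (fst p)) (snd p))"
      by (intro sum_mono) (auto simp: not_less)
    then have "(\<Sum>(j, w)\<in>S. h (E j)) / 10 \<le> (\<Sum>p\<in>S. residue N c (E (fst p)) (snd p))"
      by (simp add: sum_divide_distrib case_prod_unfold)
    also have "\<dots> = (\<Sum>p\<in>S. \<Sum>i. ?r i p)" by (simp add: residue_def)
    also have "\<dots> = (\<Sum>i. \<Sum>p\<in>S. ?r i p)"
      by (rule suminf_sum[symmetric]) (rule sum_r)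
    also have "\<dots> \<le> (\<Sum>i. if ?in i then h (N i) else 0)"
    proof (rule suminf_le[OF _ _ sum_in])
      show "summable (\<lambda>i. \<Sum>p\<in>S. ?r i p)" by (rule summable_sum) (rule sum_r)
      fix i
      let ?S = "{p \<in> S. E (fst p) < N i \<and> agree (E (fst p)) (c i) (snd p)}"
      have sub: "?in i" if "p \<in> ?S" for p
        using that below[of "fst p" "snd p" "E (fst p)" i] P(2)[of "fst p" "snd p"]
        by (auto simp: S_def)
      have "(\<Sum>p\<in>S. ?r i p) = (\<Sum>p\<in>?S. h (N i))"
        using fin by (subst sum.inter_filter) auto
      also have "\<dots> \<le> (if ?in i then h (N i) else 0)"
      \<comment> \<open>The members are disjoint, so a cover element lies inside at most one of them
        and is counted once.\<close>
      proof (rule sum_const_subsingleton)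
        show "x = y" if "x \<in> ?S" "y \<in> ?S" for x y
          using that P(5)[of "fst x" "snd x" "fst y" "snd y" "c i"] by (auto simp: S_def)
        show "0 \<le> (if ?in i then h (N i) else 0)" using h_pos by (simp add: less_imp_le)
        show "h (N i) \<le> (if ?in i then h (N i) else 0)" if "x \<in> ?S" for x
          using sub[OF that] by simp
      qed
      finally show "(\<Sum>p\<in>S. ?r i p) \<le> (if ?in i then h (N i) else 0)" .
    qed
    also have "\<dots> = residue N c a v" by (simp add: residue_def)
    finally show False using S_large res by simp
  qed
  then obtain j w where "(j, w) \<in> S" "residue N c (E j) w < h (E j) / 10" by auto
  then show thesis using that[of j w] P(2)[of j w] by (auto simp: S_def)
qed

text \<open>Iterating \<open>run_step\<close> gives nested cylinders, each ending in a new run, that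
  shrink to a sequence \<open>x\<close>. A cover element of length \<open>N i\<close> containing
  \<open>x\<close> would contain the cylinder of stage \<open>N i\<close>, which has at least that
  length, but no stage is hit.\<close>

lemma run_avoiding_aux:
  assumes N: "summable (\<lambda>i. h (N i))"
    and v: "\<And>i. v i \<in> D" "1 \<le> q ^ a * h a" "\<not> hit N c a v" "residue N c a v < h a / 10"
  obtains x where "\<forall>i. x i \<in> D" "infinite {j. run j x}" "\<forall>i. \<not> agree (N i) (c i) x"
proof -
  define good where "good = (\<lambda>(n, v). (\<forall>i. v i \<in> D) \<and> 1 \<le> q ^ n * h n \<and> \<not> hit N c n v
     \<and> residue N c n v < h n / 10)"
  define nxt where "nxt = (\<lambda>(n, v) (n', w). \<exists>j. n < M j \<and> n' = E j \<and> agree n v w \<and> run j w)"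
  have step: "\<exists>y. good y \<and> nxt x y" if "good x" for x
  proof -
    obtain n v where x: "x = (n, v)" by (cases x)
    have g: "\<And>i. v i \<in> D" "1 \<le> q ^ n * h n" "\<not> hit N c n v" "residue N c n v < h n / 10"
      using that by (auto simp: x good_def)
    obtain j w where jw: "n < M j" "\<forall>i. w i \<in> D" "agree n v w" "run j w" "\<not> hit N c (E j) w"
      "residue N c (E j) w < h (E j) / 10"
      by (rule run_step[of v n N c, OF g(1,2) N g(3,4)])
    have "1 \<le> q ^ E j * h (E j)" using g(2) g_mono[of n "E j"] jw(1) by linarith
    then have "good (E j, w) \<and> nxt x (E j, w)" using jw by (auto simp: good_def nxt_def x)
    then show ?thesis by blast
  qed
  have "good (a, v)" using v by (simp add: good_def)
  then obtain f where f: "f 0 = (a, v)" "\<And>k. good (f k)" "\<And>k. nxt (f k) (f (Suc k))"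
    using dependent_nat_choice[of "\<lambda>k x. good x \<and> (k = 0 \<longrightarrow> x = (a, v))" "\<lambda>_. nxt"] step
    by (metis nat.distinct(1))
  define n where "n k = fst (f k)" for k
  define w where "w k = snd (f k)" for k
  have fk: "f k = (n k, w k)" for k by (simp add: n_def w_def)
  have nx: "\<exists>j. n k < M j \<and> n (Suc k) = E j \<and> agree (n k) (w k) (w (Suc k)) \<and> run j (w (Suc k))" for k
    using f(3)[of k] unfolding fk nxt_def by simp
  have "n k < n (Suc k)" for k using nx[of k] by auto
  then have n_mono: "strict_mono n" by (simp add: strict_mono_Suc_iff)
  have n_ge: "k \<le> n k" for k by (rule strict_mono_imp_increasing[OF n_mono])
  have chain: "agree (n k) (w k) (w k')" if "k \<le> k'" for k k'
    using that
  proof (induction k' rule: dec_induct)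
    case (step m)
    have "agree (n k) (w m) (w (Suc m))"
      using nx[of m] agree_mono[of "n m"] step.hyps n_mono by (meson less_imp_le_nat strict_mono_less_eq)
    then show ?case using step.IH agree_trans by blast
  qed (simp add: agree_def)
  \<comment> \<open>Lengths grow by at least 1 per stage, so digit \<open>i\<close> is settled from
    stage \<open>Suc i\<close> on.\<close>
  define x where "x i = w (Suc i) i" for i
  have wx: "agree (n k) (w k) x" for k
    unfolding agree_def
  proof (intro allI impI)
    fix i assume i: "i < n k"
    have "i < n (Suc i)" using n_ge[of "Suc i"] by simp
    then show "w k i = x i"
      using chain[of k "Suc i"] chain[of "Suc i" k] i unfolding x_def agree_def
      by (metis nat_le_linear)
  qed
  show thesis
  proof (rule that[of x]; (intro allI)?)
    have "w k i \<in> D" for k i using f(2)[of k] by (simp add: fk good_def)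
    then show "x i \<in> D" for i by (simp add: x_def)
    show "infinite {j. run j x}"
      unfolding infinite_nat_iff_unbounded
    proof
      fix b
      \<comment> \<open>At stage \<open>M b\<close> the length is at least \<open>M b\<close>, which
        forces the next run to have index above \<open>b\<close>.\<close>
      obtain j where j: "n (M b) < M j" "n (Suc (M b)) = E j" "run j (w (Suc (M b)))"
        using nx[of "M b"] by blast
      have "M b < M j" using n_ge[of "M b"] j(1) by linarith
      then have "b < j" using strict_M by (simp add: strict_mono_less)
      moreover have "run j x" using j(3) wx[of "Suc (M b)"] j(2) by (auto simp: run_def agree_def)
      ultimately show "\<exists>n>b. n \<in> {j. run j x}" by blast
    qed
    show "\<not> agree (N i) (c i) x" for i
    proof
      assume ag: "agree (N i) (c i) x"
      have "agree (N i) (w (N i)) x" using wx[of "N i"] n_ge[of "N i"] agree_mono by blast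
      then have "agree (N i) (c i) (w (N i))" using ag agree_sym agree_trans by blast
      then have "hit N c (n (N i)) (w (N i))" using n_ge[of "N i"] by (auto simp: hit_def)
      then show False using f(2)[of "N i"] by (simp add: fk good_def)
    qed
  qed
qed

text \<open>A start for the descent is found by averaging over the q^a words of length
  \<open>a\<close>: each cover element counts towards the residue of at most one of them. None is
  hit, as all elements are longer than \<open>a\<close>.\<close>

lemma run_avoiding:
  assumes N: "summable (\<lambda>i. h (N i))" "\<And>i. a < N i" "(\<Sum>i. h (N i)) < q ^ a * h a / 10"
    and ga: "1 \<le> q ^ a * h a"
  obtains x where "\<forall>i. x i \<in> D" "infinite {j. run j x}" "\<forall>i. \<not> agree (N i) (c i) x"
proof -
  let ?W = "words a {} (\<lambda>_. z)"
  have q0: "0 < q" using q_ge2 by simp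
  have cW: "real (card ?W) = q ^ a" by (subst card_words_real) auto
  have sum_r: "summable (\<lambda>i. if a < N i \<and> agree a (c i) v then h (N i) else 0)" for v
    by (rule summable_filter[OF N(1)]) (use h_pos in \<open>auto simp: less_imp_le\<close>)
  have "\<exists>v\<in>?W. residue N c a v < h a / 10"
  proof (rule ccontr)
    assume "\<not> ?thesis"
    then have "(\<Sum>v\<in>?W. h a / 10) \<le> (\<Sum>v\<in>?W. residue N c a v)"
      by (intro sum_mono) (auto simp: not_less)
    then have "q ^ a * h a / 10 \<le> (\<Sum>v\<in>?W. residue N c a v)" by (simp add: cW)
    also have "\<dots> = (\<Sum>i. \<Sum>v\<in>?W. if a < N i \<and> agree a (c i) v then h (N i) else 0)"
      unfolding residue_def by (rule suminf_sum[symmetric]) (rule sum_r)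
    also have "\<dots> \<le> (\<Sum>i. h (N i))"
    proof (rule suminf_le[OF _ _ N(1)])
      show "summable (\<lambda>i. \<Sum>v\<in>?W. if a < N i \<and> agree a (c i) v then h (N i) else 0)"
        by (rule summable_sum) (rule sum_r)
      fix i
      have "(\<Sum>v\<in>?W. if a < N i \<and> agree a (c i) v then h (N i) else 0) =
          (\<Sum>v | v \<in> ?W \<and> agree a (c i) v. h (N i))"
        using N(2) by (subst sum.inter_filter) auto
      also have "\<dots> \<le> h (N i)"
      proof (rule sum_const_subsingleton)
        fix x y assume "x \<in> {v \<in> ?W. agree a (c i) v}" "y \<in> {v \<in> ?W. agree a (c i) v}"
        then have "x j = y j" for j
          using words_pad[of x a "{}" _ j] words_pad[of y a "{}" _ j]
          by (cases "j < a") (auto simp: agree_def)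
        then show "x = y" by auto
      qed (use h_pos in \<open>auto simp: less_imp_le\<close>)
      finally show "(\<Sum>v\<in>?W. if a < N i \<and> agree a (c i) v then h (N i) else 0) \<le> h (N i)" .
    qed
    finally show False using N(3) by simp
  qed
  then obtain v where v: "v \<in> ?W" "residue N c a v < h a / 10" by blast
  have "\<not> hit N c a v" using N(2) by (auto simp: hit_def not_le)
  moreover have "v i \<in> D" for i using words_mem_D[OF v(1)] by simp
  ultimately show thesis using run_avoiding_aux[OF N(1) _ ga _ v(2)] that by metis
qed

end

section \<open>Hausdorff measures\<close>

lemma dimension_functionD:
  assumes "dimension_function f"
  shows "\<And>r. 0 < r \<Longrightarrow> 0 < f r" "\<And>r s. 0 < r \<Longrightarrow> r \<le> s \<Longrightarrow> f r \<le> f s"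
    "(f \<longlongrightarrow> 0) (at_right 0)"
  using assms by (auto simp: dimension_function_def mono_on_def)

lemma gauge_val_le:
  assumes "dimension_function f" "bounded U" "diameter U \<le> r" "0 < r"
  shows "gauge_val f U \<le> ennreal (f r)"
  using dimension_functionD(2)[OF assms(1), of "diameter U" r] diameter_ge_0[OF assms(2)] assms(3)
  by (auto simp: gauge_val_def intro: ennreal_leI)

lemma hausdorff_pre_le_suminf:
  assumes "A \<subseteq> (\<Union>i. U i)" "\<And>i. bounded (U i)" "\<And>i. diameter (U i) \<le> \<delta>"
  shows "hausdorff_pre f \<delta> A \<le> (\<Sum>i. gauge_val f (U i))"
  unfolding hausdorff_pre_def by (rule INF_lower) (use assms in auto)

lemma hausdorff_pre_mono: "A \<subseteq> B \<Longrightarrow> hausdorff_pre f \<delta> A \<le> hausdorff_pre f \<delta> B"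
  unfolding hausdorff_pre_def by (rule INF_superset_mono) auto

lemma hausdorff_pre_finite:
  assumes f: "dimension_function f" and I: "finite I" "A \<subseteq> (\<Union>i\<in>I. U i)"
    and U: "\<And>i. i \<in> I \<Longrightarrow> bounded (U i)" "\<And>i. i \<in> I \<Longrightarrow> diameter (U i) \<le> r"
    and r: "0 < r" "r \<le> \<delta>"
  shows "hausdorff_pre f \<delta> A \<le> ennreal (real (card I) * f r)"
proof -
  obtain e where e: "bij_betw e {0..<card I} I" using ex_bij_betw_nat_finite[OF I(1)] by blast
  have eI: "e i \<in> I" if "i < card I" for i using e that by (auto simp: bij_betw_def)
  let ?V = "\<lambda>i. if i < card I then U (e i) else {}"
  have Vd: "diameter (?V i) \<le> \<delta>" for i
    using U(2)[OF eI, of i] r by (cases "i < card I") auto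
  have "(\<Union>i\<in>I. U i) \<subseteq> (\<Union>i. ?V i)"
  proof
    fix x assume "x \<in> (\<Union>i\<in>I. U i)"
    then obtain i where "i \<in> e ` {0..<card I}" "x \<in> U i" using bij_betw_imp_surj_on[OF e] by auto
    then obtain j where "j < card I" "x \<in> U (e j)" by auto
    then have "x \<in> ?V j" by simp
    then show "x \<in> (\<Union>i. ?V i)" by blast
  qed
  then have "hausdorff_pre f \<delta> A \<le> (\<Sum>i. gauge_val f (?V i))"
    using I(2) U(1) eI Vd by (intro hausdorff_pre_le_suminf) auto
  also have "\<dots> = (\<Sum>i<card I. gauge_val f (?V i))"
    by (rule suminf_finite) (auto simp: gauge_val_def)
  also have "\<dots> \<le> (\<Sum>i<card I. ennreal (f r))"
    using U eI r by (intro sum_mono) (auto intro!: gauge_val_le[OF f])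
  also have "\<dots> = ennreal (real (card I) * f r)"
    using dimension_functionD(1)[OF f r(1)] by (simp add: ennreal_mult ennreal_of_nat_eq_real_of_nat)
  finally show ?thesis .
qed

lemma hausdorff_pre_UN: "hausdorff_pre f \<delta> (\<Union>n. A n) \<le> (\<Sum>n. hausdorff_pre f \<delta> (A n))"
proof (rule ennreal_le_epsilon)
  fix e :: real
  assume fin: "(\<Sum>n. hausdorff_pre f \<delta> (A n)) < top" and e: "0 < e"
  have "\<exists>U. A n \<subseteq> (\<Union>i. U i) \<and> (\<forall>i. bounded (U i) \<and> diameter (U i) \<le> \<delta>) \<and>
     (\<Sum>i. gauge_val f (U i)) < hausdorff_pre f \<delta> (A n) + ennreal (e * (1/2) ^ Suc n)" for n
  proof -
    have "hausdorff_pre f \<delta> (A n) \<le> (\<Sum>n\<in>{n}. hausdorff_pre f \<delta> (A n))" by simp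
    also have "\<dots> \<le> (\<Sum>n. hausdorff_pre f \<delta> (A n))"
      by (rule sum_le_suminf) auto
    finally have "hausdorff_pre f \<delta> (A n) < top" using fin by simp
    then have "hausdorff_pre f \<delta> (A n) < hausdorff_pre f \<delta> (A n) + ennreal (e * (1/2) ^ Suc n)"
      using e by (simp add: ennreal_add_left_cancel_less less_top)
    then show ?thesis
      by (subst (asm) (1) hausdorff_pre_def) (auto simp: INF_less_iff)
  qed
  then obtain U where U: "\<And>n. A n \<subseteq> (\<Union>i. U n i)"
    "\<And>n i. bounded (U n i)" "\<And>n i. diameter (U n i) \<le> \<delta>"
    "\<And>n. (\<Sum>i. gauge_val f (U n i)) < hausdorff_pre f \<delta> (A n) + ennreal (e * (1/2) ^ Suc n)"
    by metis
  let ?V = "\<lambda>k. U (fst (prod_decode k)) (snd (prod_decode k))"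
  have "(\<Union>n. A n) \<subseteq> (\<Union>k. ?V k)"
  proof
    fix x assume "x \<in> (\<Union>n. A n)"
    then obtain n i where "x \<in> U n i" using U(1) by blast
    then have "x \<in> ?V (prod_encode (n, i))" by simp
    then show "x \<in> (\<Union>k. ?V k)" by blast
  qed
  then have "hausdorff_pre f \<delta> (\<Union>n. A n) \<le> (\<Sum>k. gauge_val f (?V k))"
    using U(2,3) by (intro hausdorff_pre_le_suminf)
  also have "\<dots> = (\<Sum>n. \<Sum>i. gauge_val f (U n i))"
  proof -
    have "(\<Sum>k. (\<lambda>(n, i). gauge_val f (U n i)) (prod_decode k)) = (\<Sum>n. \<Sum>i. gauge_val f (U n i))"
      by (rule suminf_ennreal_2dimen) simp
    then show ?thesis by (simp add: case_prod_unfold)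
  qed
  also have "\<dots> \<le> (\<Sum>n. hausdorff_pre f \<delta> (A n) + ennreal (e * (1/2) ^ Suc n))"
    using U(4) by (intro suminf_le) (auto simp: less_imp_le)
  also have "\<dots> = (\<Sum>n. hausdorff_pre f \<delta> (A n)) + (\<Sum>n. ennreal (e * (1/2) ^ Suc n))"
    by (rule suminf_add[symmetric]) auto
  also have "(\<Sum>n. ennreal (e * (1/2) ^ Suc n)) = ennreal e"
  proof -
    have "(\<lambda>n. e * (1/2) ^ Suc n) sums (e * 1)" by (intro sums_mult power_half_series)
    then have "(\<Sum>n. ennreal (e * (1/2) ^ Suc n)) = ennreal (e * 1)"
      by (intro suminf_ennreal_eq) (use e in auto)
    then show ?thesis by simp
  qed
  finally show "hausdorff_pre f \<delta> (\<Union>n. A n) \<le> (\<Sum>n. hausdorff_pre f \<delta> (A n)) + ennreal e" .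
qed

lemma hausdorff_f_measure_mono: "A \<subseteq> B \<Longrightarrow> hausdorff_f_measure f A \<le> hausdorff_f_measure f B"
  unfolding hausdorff_f_measure_def by (intro SUP_mono) (auto intro: hausdorff_pre_mono)

lemma hausdorff_pre_le_measure: "0 < \<delta> \<Longrightarrow> hausdorff_pre f \<delta> A \<le> hausdorff_f_measure f A"
  unfolding hausdorff_f_measure_def by (rule SUP_upper) auto

lemma hausdorff_f_measure_leI:
  "(\<And>\<delta>. 0 < \<delta> \<Longrightarrow> hausdorff_pre f \<delta> A \<le> c) \<Longrightarrow> hausdorff_f_measure f A \<le> c"
  unfolding hausdorff_f_measure_def by (rule SUP_least) auto

lemma hausdorff_pre_null: "hausdorff_f_measure f A = 0 \<Longrightarrow> 0 < \<delta> \<Longrightarrow> hausdorff_pre f \<delta> A = 0"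
  using hausdorff_pre_le_measure[of \<delta> f A] by simp

lemma hausdorff_f_measure_null_UN:
  fixes A :: "nat \<Rightarrow> real set"
  assumes "\<And>n. hausdorff_f_measure f (A n) = 0"
  shows "hausdorff_f_measure f (\<Union>n. A n) = 0"
proof -
  have "hausdorff_f_measure f (\<Union>n. A n) \<le> 0"
  proof (rule hausdorff_f_measure_leI)
    fix \<delta> :: real assume "0 < \<delta>"
    then show "hausdorff_pre f \<delta> (\<Union>n. A n) \<le> 0"
      using hausdorff_pre_UN[of f \<delta> A] hausdorff_pre_null[OF assms] by simp
  qed
  then show ?thesis by simp
qed

lemma hausdorff_f_measure_Un_null:
  assumes "hausdorff_f_measure f B = 0"
  shows "hausdorff_f_measure f (A \<union> B) \<le> hausdorff_f_measure f A"
proof (rule hausdorff_f_measure_leI)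
  fix \<delta> :: real assume d: "0 < \<delta>"
  let ?S = "\<lambda>n::nat. if n = 0 then A else B"
  have "A \<union> B = (\<Union>n. ?S n)" by (auto split: if_splits)
  then have "hausdorff_pre f \<delta> (A \<union> B) \<le> (\<Sum>n. hausdorff_pre f \<delta> (?S n))"
    using hausdorff_pre_UN[of f \<delta> ?S] by simp
  also have "\<dots> = (\<Sum>n\<in>{0}. hausdorff_pre f \<delta> (?S n))"
    by (rule suminf_finite) (use hausdorff_pre_null[OF assms d] in auto)
  also have "\<dots> \<le> hausdorff_f_measure f A" using hausdorff_pre_le_measure[OF d] by simp
  finally show "hausdorff_pre f \<delta> (A \<union> B) \<le> hausdorff_f_measure f A" .
qed

text \<open>The convergence half of Borel-Cantelli. The bound on \<open>E n\<close> is only required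
  from an index depending on \<delta> on, since the sets covering \<open>E n\<close> need not be
  smaller than \<delta> before.\<close>

lemma hausdorff_f_measure_limsup_null:
  fixes a :: "nat \<Rightarrow> real"
  assumes a: "summable a" "\<And>n. 0 \<le> a n"
    and E: "\<And>\<delta>. 0 < \<delta> \<Longrightarrow> eventually (\<lambda>n. hausdorff_pre f \<delta> (E n) \<le> ennreal (a n)) sequentially"
    and A: "\<And>x N. x \<in> A \<Longrightarrow> \<exists>n\<ge>N. x \<in> E n"
  shows "hausdorff_f_measure f A = 0"
proof -
  have "hausdorff_f_measure f A \<le> 0"
  proof (rule hausdorff_f_measure_leI, rule ennreal_le_epsilon)
    fix \<delta> e :: real assume d: "0 < \<delta>" and e: "0 < e"
    obtain N0 where N0: "\<And>n. n \<ge> N0 \<Longrightarrow> hausdorff_pre f \<delta> (E n) \<le> ennreal (a n)"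
      using E[OF d] by (auto simp: eventually_sequentially)
    obtain N1 where N1: "\<And>n. n \<ge> N1 \<Longrightarrow> norm (\<Sum>i. a (i + n)) < e"
      using suminf_exist_split[OF e a(1)] by blast
    define N where "N = max N0 N1"
    have "A \<subseteq> (\<Union>n. E (n + N))"
    proof
      fix x assume "x \<in> A"
      then obtain n where "n \<ge> N" "x \<in> E n" using A[of x N] by blast
      then have "x \<in> E ((n - N) + N)" by simp
      then show "x \<in> (\<Union>n. E (n + N))" by blast
    qed
    then have "hausdorff_pre f \<delta> A \<le> hausdorff_pre f \<delta> (\<Union>n. E (n + N))"
      by (rule hausdorff_pre_mono)
    also have "\<dots> \<le> (\<Sum>n. hausdorff_pre f \<delta> (E (n + N)))" by (rule hausdorff_pre_UN)
    also have "\<dots> \<le> (\<Sum>n. ennreal (a (n + N)))"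
      using N0 by (intro suminf_le) (auto simp: N_def)
    also have "\<dots> = ennreal (\<Sum>n. a (n + N))"
      using a by (intro suminf_ennreal2) (auto simp: summable_iff_shift)
    also have "\<dots> \<le> ennreal e" using N1[of N] by (intro ennreal_leI) (auto simp: N_def)
    finally show "hausdorff_pre f \<delta> A \<le> 0 + ennreal e" by simp
  qed
  then show ?thesis by simp
qed

section \<open>Avoiding a cover without a bound on the terms of the series\<close>

context digit_runs
begin

text \<open>Lengthening the runs \<open>s\<close> until each term of the series is at most 1 keeps it divergent, since
  one more step divides a term by at most \<open>q\<close>.\<close>

lemma run_avoiding_uncapped:
  fixes h :: "nat \<Rightarrow> real"
  assumes h: "\<And>n. 0 < h n" "\<And>n m. n \<le> m \<Longrightarrow> h m \<le> h n"
      "\<And>n m. n \<le> m \<Longrightarrow> q ^ n * h n \<le> q ^ m * h m" "\<And>B. \<exists>n. B < q ^ n * h n" "h \<longlonglongrightarrow> 0"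
    and div: "\<not> summable (\<lambda>j. q ^ M j * h (M j + s j))"
    and N: "summable (\<lambda>i. h (N i))" "\<And>i. a < N i" "(\<Sum>i. h (N i)) < q ^ a * h a / 10"
    and ga: "1 \<le> q ^ a * h a"
  obtains x where "\<forall>i. x i \<in> D" "infinite {j. run j x}" "\<forall>i. \<not> agree (N i) (c i) x"
proof -
  have q0: "0 < q" using q_ge2 by simp
  define Q where "Q j u \<longleftrightarrow> s j \<le> u \<and> q ^ M j * h (M j + u) \<le> 1" for j u
  have "\<exists>u. Q j u" for j
  proof -
    have "eventually (\<lambda>n. h n < 1 / q ^ M j) sequentially"
      using q0 by (intro order_tendstoD(2)[OF h(5)]) auto
    then obtain n0 where "\<And>n. n \<ge> n0 \<Longrightarrow> h n < 1 / q ^ M j"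
      by (auto simp: eventually_sequentially)
    then have "h (M j + (s j + n0)) < 1 / q ^ M j" by auto
    then have "Q j (s j + n0)" using q0 by (simp add: Q_def field_simps)
    then show ?thesis by blast
  qed
  then have Qs: "Q j (LEAST u. Q j u)" for j by (meson LeastI_ex)
  define s' where "s' j = (LEAST u. Q j u)" for j
  have s': "s j \<le> s' j" "q ^ M j * h (M j + s' j) \<le> 1" for j
    using Qs[of j] by (auto simp: Q_def s'_def)
  have cases: "s' j = s j \<or> 1 / q < q ^ M j * h (M j + s' j)" for j
  proof (rule ccontr)
    assume c: "\<not> ?thesis"
    then obtain u where u: "s' j = Suc u" "s j \<le> u" using s'(1)[of j] by (cases "s' j") auto
    have "q ^ (M j + u) * h (M j + u) \<le> q ^ (M j + Suc u) * h (M j + Suc u)" by (rule h(3)) simp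
    then have "h (M j + u) \<le> q * h (M j + Suc u)" using q0 by (simp add: mult_ac)
    then have "q ^ M j * h (M j + u) \<le> q * (q ^ M j * h (M j + Suc u))"
      using q0 by (simp add: mult_ac)
    also have "\<dots> \<le> 1" using c q0 u(1) by (simp add: field_simps)
    finally have "Q j u" using u(2) by (simp add: Q_def)
    then have "s' j \<le> u" unfolding s'_def by (rule Least_le)
    then show False using u(1) by simp
  qed
  \<comment> \<open>A convergent series has terms below 1 / q eventually; by \<open>cases\<close>
    these belong to runs that were not lengthened, so the original series would converge
    too.\<close>
  have div': "\<not> summable (\<lambda>j. q ^ M j * h (M j + s' j))"
  proof
    assume sm: "summable (\<lambda>j. q ^ M j * h (M j + s' j))"
    have "eventually (\<lambda>j. q ^ M j * h (M j + s' j) < 1 / q) sequentially"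
      using q0 by (intro order_tendstoD(2)[OF summable_LIMSEQ_zero[OF sm]]) auto
    then have "eventually (\<lambda>j. q ^ M j * h (M j + s' j) = q ^ M j * h (M j + s j)) sequentially"
      by (rule eventually_mono) (metis cases less_asym)
    then have "summable (\<lambda>j. q ^ M j * h (M j + s' j)) \<longleftrightarrow> summable (\<lambda>j. q ^ M j * h (M j + s j))"
      by (rule summable_cong)
    then show False using sm div by simp
  qed
  interpret capped: run_gauge D z M s' h
    by unfold_locales (use h s' div' in auto)
  obtain x where x: "\<forall>i. x i \<in> D" "infinite {j. capped.run j x}" "\<forall>i. \<not> agree (N i) (c i) x"
    by (rule capped.run_avoiding[of N a c, OF N ga])
  have "{j. capped.run j x} \<subseteq> {j. run j x}"
  proof (intro Collect_mono impI)
    fix j assume "capped.run j x"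
    moreover have "{M j..<M j + s j} \<subseteq> {M j..<M j + s' j}" using s'(1)[of j] by auto
    ultimately show "run j x" unfolding run_def capped.run_def by blast
  qed
  then have "infinite {j. run j x}" using x(2) finite_subset by blast
  then show thesis using x that[of x] by blast
qed

end

section \<open>Digit expansions\<close>

locale cantor_digits = digit_words +
  fixes b :: nat
  assumes b_ge2: "2 \<le> b" and D_less: "d \<in> D \<Longrightarrow> d < b" and z_end: "z = 0 \<or> z = b - 1"
begin

definition "expand" :: "(nat \<Rightarrow> nat) \<Rightarrow> real" where
  "expand d = (\<Sum>i. real (d i) / real b ^ Suc i)"

primrec prefix :: "nat \<Rightarrow> (nat \<Rightarrow> nat) \<Rightarrow> nat" where
  "prefix 0 d = 0"
| "prefix (Suc n) d = b * prefix n d + d n"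

lemma b_pos: "0 < real b" using b_ge2 by simp

lemma prefix_sum: "(\<Sum>i<n. real (d i) / real b ^ Suc i) = real (prefix n d) / real b ^ n"
  by (induction n) (use b_pos in \<open>auto simp: field_simps\<close>)

lemma top_digit_sums: "(\<lambda>i. (real b - 1) / real b ^ Suc (i + n)) sums (1 / real b ^ n)"
proof -
  have "(\<lambda>i. (1 / real b) ^ i) sums (1 / (1 - 1 / real b))"
    using b_ge2 by (intro geometric_sums) auto
  then have "(\<lambda>i. ((real b - 1) / real b ^ Suc n) * (1 / real b) ^ i) sums
      (((real b - 1) / real b ^ Suc n) * (1 / (1 - 1 / real b)))"
    by (rule sums_mult)
  moreover have "((real b - 1) / real b ^ Suc n) * (1 / real b) ^ i =
      (real b - 1) / real b ^ Suc (i + n)" for i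
    by (simp add: power_add power_one_over field_simps)
  moreover have "((real b - 1) / real b ^ Suc n) * (1 / (1 - 1 / real b)) = 1 / real b ^ n"
    using b_ge2 by (simp add: field_simps)
  ultimately show ?thesis by simp
qed

lemma digit_le: "(\<And>i. d i \<in> D) \<Longrightarrow> real (d i) \<le> real b - 1"
  using D_less[of "d i"] by (simp add: of_nat_diff[symmetric])

lemma digit_summable:
  assumes "\<And>i. d i \<in> D"
  shows "summable (\<lambda>i. real (d (i + n)) / real b ^ Suc (i + n))"
  by (rule summable_comparison_test'[OF sums_summable[OF top_digit_sums[of n]]])
    (use digit_le[OF assms] in \<open>auto intro!: divide_right_mono\<close>)

lemma expand_split:
  assumes "\<And>i. d i \<in> D"
  shows "expand d = real (prefix n d) / real b ^ n + (\<Sum>i. real (d (i + n)) / real b ^ Suc (i + n))"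
  using suminf_split_initial_segment[OF digit_summable[of d 0, OF assms], of n]
  by (simp add: expand_def prefix_sum[symmetric])

lemma expand_bounds:
  assumes "\<And>i. d i \<in> D"
  shows "real (prefix n d) / real b ^ n \<le> expand d" "expand d \<le> (real (prefix n d) + 1) / real b ^ n"
proof -
  have "0 \<le> (\<Sum>i. real (d (i + n)) / real b ^ Suc (i + n))"
    by (rule suminf_nonneg[OF digit_summable[of d n, OF assms]]) simp
  then show "real (prefix n d) / real b ^ n \<le> expand d"
    using expand_split[of d n, OF assms] by linarith
  have "(\<Sum>i. real (d (i + n)) / real b ^ Suc (i + n)) \<le>
      (\<Sum>i. (real b - 1) / real b ^ Suc (i + n))"
    by (rule suminf_le[OF _ digit_summable[of d n, OF assms] sums_summable[OF top_digit_sums[of n]]])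
      (use digit_le[of d, OF assms] in \<open>auto intro!: divide_right_mono\<close>)
  then show "expand d \<le> (real (prefix n d) + 1) / real b ^ n"
    using expand_split[of d n, OF assms] sums_unique[OF top_digit_sums[of n]]
    by (simp add: add_divide_distrib)
qed

lemma cantor_set_eq: "cantor_set b D = expand ` {d. \<forall>i. d i \<in> D}"
proof
  show "cantor_set b D \<subseteq> expand ` {d. \<forall>i. d i \<in> D}"
    by (auto simp: cantor_set_def expand_def dest: sums_unique)
  have "expand d \<in> cantor_set b D" if "\<forall>i. d i \<in> D" for d
    using that expand_bounds[of d 0] digit_summable[of d 0]
    by (auto simp: cantor_set_def expand_def intro!: exI[of _ d] summable_sums)
  then show "expand ` {d. \<forall>i. d i \<in> D} \<subseteq> cantor_set b D" by auto
qed

lemma prefix_eq_iff: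
  assumes "\<And>i. d i \<in> D" "\<And>i. e i \<in> D"
  shows "prefix n d = prefix n e \<longleftrightarrow> agree n d e"
proof (induction n)
  case (Suc n)
  have "b * u + x = b * v + y \<longleftrightarrow> u = v \<and> x = y" if "x < b" "y < b" for u v x y
  proof
    assume eq: "b * u + x = b * v + y"
    have "(b * u + x) div b = u" "(b * v + y) div b = v" using that by simp_all
    then have "u = v" using eq by simp
    then show "u = v \<and> x = y" using eq by simp
  qed simp
  then show ?case using Suc D_less[OF assms(1)[of n]] D_less[OF assms(2)[of n]]
    by (auto simp: agree_def less_Suc_eq)
qed (simp add: agree_def)

lemma agree_expand:
  assumes "\<And>i. d i \<in> D" "\<And>i. e i \<in> D" "agree n d e"
  shows "\<bar>expand d - expand e\<bar> \<le> 1 / real b ^ n"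
proof -
  have "prefix n d = prefix n e" using assms prefix_eq_iff by blast
  then show ?thesis
    using expand_bounds[of d n] expand_bounds[of e n] assms by (simp add: add_divide_distrib)
qed

text \<open>One unit of 1 / b^n is the width of the cylinder of \<open>e\<close>, the other is the
  distance of the two points.\<close>

lemma prefix_close:
  assumes "\<And>i. d i \<in> D" "\<And>i. e i \<in> D" "\<bar>expand d - expand e\<bar> \<le> 1 / real b ^ n"
  shows "prefix n d \<le> prefix n e + 2"
proof -
  have "real (prefix n d) / real b ^ n \<le> expand d" using expand_bounds(1)[of d n] assms by blast
  also have "\<dots> \<le> expand e + 1 / real b ^ n" using assms(3) by linarith
  also have "\<dots> \<le> (real (prefix n e) + 1) / real b ^ n + 1 / real b ^ n"
    using expand_bounds(2)[of e n] assms by simp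
  also have "\<dots> = (real (prefix n e) + 2) / real b ^ n" by (simp add: add_divide_distrib)
  finally show ?thesis using b_pos by (simp add: divide_le_cancel)
qed

text \<open>This is where \<open>z\<close> has to be an extreme digit: a tail of zeros adds nothing
  to the prefix fraction, and a tail of digits b - 1 adds exactly 1 / b^m.\<close>

lemma expand_padded:
  assumes "\<And>i. w i \<in> D" "\<And>i. m \<le> i \<Longrightarrow> w i = z"
  shows "\<exists>p::nat. expand w = real p / real b ^ m"
proof -
  have split: "expand w = real (prefix m w) / real b ^ m + (\<Sum>i. real z / real b ^ Suc (i + m))"
    using expand_split[of w m, OF assms(1)] assms(2) by simp
  show ?thesis
  proof (cases "z = 0")
    case True
    then show ?thesis using split by auto
  next
    case False
    then have "real z = real b - 1" using z_end b_ge2 by (simp add: of_nat_diff)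
    then have "expand w = real (prefix m w) / real b ^ m + 1 / real b ^ m"
      using split sums_unique[OF top_digit_sums[of m]] by simp
    then have "expand w = real (prefix m w + 1) / real b ^ m" by (simp add: add_divide_distrib)
    then show ?thesis by blast
  qed
qed

text \<open>The point is compared with the one obtained by continuing the run forever, which agrees
  with it at the first \<open>n\<close> places.\<close>

lemma expand_near_endpoint:
  assumes x: "\<And>i. x i \<in> D" and run: "\<And>i. i \<in> {m..<n} \<Longrightarrow> x i = z" and "m \<le> n"
  shows "\<exists>p::nat. \<bar>expand x - real p / real b ^ m\<bar> \<le> 1 / real b ^ n"
proof -
  let ?w = "\<lambda>i. if i < n then x i else z"
  have w: "?w i \<in> D" for i using x z_mem by simp
  have "?w i = z" if "m \<le> i" for i using run that by simp
  then obtain p :: nat where "expand ?w = real p / real b ^ m" using expand_padded[of ?w m, OF w] by blast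
  moreover have "\<bar>expand x - expand ?w\<bar> \<le> 1 / real b ^ n"
    by (rule agree_expand[OF x w]) (simp add: agree_def)
  ultimately show ?thesis by auto
qed

text \<open>Two level-\<open>n\<close> prefixes of points of \<open>U\<close> differ by at most 2, which leaves five candidates.\<close>

lemma five_cylinders:
  assumes U: "bounded U" "diameter U \<le> 1 / real b ^ n"
  obtains c :: "nat \<Rightarrow> nat \<Rightarrow> nat" where
    "\<forall>x. (\<forall>i. x i \<in> D) \<and> expand x \<in> U \<longrightarrow> (\<exists>k<5. agree n (c k) x)"
proof (cases "\<exists>e. (\<forall>i. e i \<in> D) \<and> expand e \<in> U")
  case True
  then obtain e where e: "\<And>i. e i \<in> D" "expand e \<in> U" by blast
  \<comment> \<open>The index is shifted by 2 so that k = 0, ..., 4 covers the differences -2, ...,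
    2. If no sequence has the required prefix, \<open>c k\<close> is arbitrary and no point needs
    it.\<close>
  define c where "c k = (SOME d. (\<forall>i. d i \<in> D) \<and> prefix n d + 2 = prefix n e + k)" for k
  have "\<exists>k<5. agree n (c k) x" if x: "\<forall>i. x i \<in> D" "expand x \<in> U" for x
  proof -
    have "\<bar>expand x - expand e\<bar> \<le> 1 / real b ^ n"
      using diameter_bounded_bound[OF U(1) x(2) e(2)] U(2) by (simp add: dist_real_def)
    then have close: "prefix n x \<le> prefix n e + 2" "prefix n e \<le> prefix n x + 2"
      using prefix_close[of x e n] prefix_close[of e x n] x(1) e(1) by (simp_all add: abs_minus_commute)
    define k where "k = prefix n x + 2 - prefix n e"
    have k: "k < 5" "prefix n x + 2 = prefix n e + k" using close by (auto simp: k_def)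
    have "(\<forall>i. c k i \<in> D) \<and> prefix n (c k) + 2 = prefix n e + k"
      unfolding c_def by (rule someI[of _ x]) (use x(1) k(2) in auto)
    then have "agree n (c k) x" using prefix_eq_iff[of "c k" x n] x(1) k(2) by auto
    then show ?thesis using k(1) by blast
  qed
  then show thesis using that[of c] by blast
next
  case False
  then show thesis using that[of "\<lambda>_ _. 0"] by blast
qed

lemma pow_to_zero: "(\<lambda>n. 1 / real b ^ n) \<longlonglongrightarrow> 0"
proof -
  have "(\<lambda>n. (1 / real b) ^ n) \<longlonglongrightarrow> 0" using b_ge2 by (intro LIMSEQ_power_zero) auto
  then show ?thesis by (simp add: power_one_over)
qed

lemma powr_level:
  assumes "real b powr \<gamma> = q"
  shows "(real b ^ n) powr \<gamma> = q ^ n" "(1 / real b ^ n) powr \<gamma> = 1 / q ^ n"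
proof -
  have "(real b ^ n) powr \<gamma> = real b powr (real n * \<gamma>)"
    using b_pos by (simp add: powr_realpow[symmetric] powr_powr)
  also have "\<dots> = (real b powr \<gamma>) powr real n" by (simp add: powr_powr mult.commute)
  also have "\<dots> = q ^ n" unfolding assms using q_ge2 by (subst powr_realpow) auto
  finally show *: "(real b ^ n) powr \<gamma> = q ^ n" .
  show "(1 / real b ^ n) powr \<gamma> = 1 / q ^ n" using b_pos by (simp add: powr_divide *)
qed

end

section \<open>Points with finitely and with infinitely many runs\<close>

locale cantor_runs = cantor_digits D z b + digit_runs D z M s
  for D :: "nat set" and z b :: nat and M s :: "nat \<Rightarrow> nat"
begin

text \<open>The points without runs from index \<open>J\<close> on are covered by the cylinders of
  some level \<open>n\<close> around words with no run in a finite set \<open>F\<close>. By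
  \<open>card_no_run_le\<close> these are a small fraction of the q^n words, while each cylinder has
  gauge at most C / q^n.\<close>

lemma few_runs_null:
  assumes f: "dimension_function f" and \<gamma>: "real b powr \<gamma> = q"
    and fle: "0 < r0" "\<And>r. 0 < r \<Longrightarrow> r \<le> r0 \<Longrightarrow> f r \<le> C * r powr \<gamma>"
    and div: "\<not> summable (\<lambda>j. 1 / q ^ s j)"
  shows "hausdorff_f_measure f (expand ` {x. (\<forall>i. x i \<in> D) \<and> finite {j. run j x}}) = 0"
proof -
  have q0: "0 < q" using q_ge2 by simp
  have "0 < C * r0 powr \<gamma>" using fle(2)[of r0] fle(1) dimension_functionD(1)[OF f fle(1)] by simp
  then have C0: "0 < C" using fle(1) by (simp add: zero_less_mult_iff)
  define B where "B J = expand ` {x. (\<forall>i. x i \<in> D) \<and> (\<forall>j\<ge>J. \<not> run j x)}" for J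
  have "hausdorff_f_measure f (B J) = 0" for J
  proof -
    have "hausdorff_f_measure f (B J) \<le> 0"
    proof (rule hausdorff_f_measure_leI, rule ennreal_le_epsilon)
      fix \<delta> e :: real assume \<delta>: "0 < \<delta>" and e: "0 < e"
      \<comment> \<open>At most 4 * q^n / T words remain, of gauge at most C / q^n each, for a total
        of \<open>e\<close>.\<close>
      define T where "T = 4 * C / e"
      have T0: "0 < T" using C0 e by (simp add: T_def)
      have "0 \<le> 1 / q ^ s j" "1 / q ^ s j \<le> 1" for j using q_ge2 by (simp_all add: divide_le_eq)
      then obtain F where F: "finite F" "\<forall>j\<in>F. J \<le> j" "T \<le> (\<Sum>j\<in>F. 1 / q ^ s j)"
        by (rule nonsummable_partial_sum[of "\<lambda>j. 1 / q ^ s j" T J, OF _ _ div]) (use T0 in auto)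
      have "eventually (\<lambda>n. 1 / real b ^ n < min \<delta> r0) sequentially"
        using \<delta> fle(1) by (intro order_tendstoD(2)[OF pow_to_zero]) auto
      then obtain n0 where n0: "\<And>n. n \<ge> n0 \<Longrightarrow> 1 / real b ^ n < min \<delta> r0"
        by (auto simp: eventually_sequentially)
      define n where "n = n0 + (\<Sum>j\<in>F. M j + s j)"
      have nF: "M j + s j \<le> n" if "j \<in> F" for j
        using member_le_sum[OF that, of "\<lambda>j. M j + s j"] F(1) by (simp add: n_def)
      let ?I = "{w \<in> words n {} (\<lambda>_. z). \<forall>j\<in>F. \<not> run j w}"
      let ?r = "1 / real b ^ n"
      let ?U = "\<lambda>w. expand ` {x. (\<forall>i. x i \<in> D) \<and> agree n w x}"
      have r: "0 < ?r" "?r \<le> \<delta>" "?r \<le> r0" using n0[of n] b_pos by (auto simp: n_def)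
      have dist: "norm (x - y) \<le> ?r" if xy: "x \<in> ?U w" "y \<in> ?U w" for x y w
      proof -
        obtain u v where uv: "x = expand u" "y = expand v" "\<forall>i. u i \<in> D" "\<forall>i. v i \<in> D"
          "agree n w u" "agree n w v" using xy by auto
        then have "agree n u v" using agree_trans[of n u w v] agree_sym[of n w u] by blast
        then show ?thesis using agree_expand[of u v n] uv by simp
      qed
      have U: "bounded (?U w)" "diameter (?U w) \<le> ?r" for w
      proof -
        show "diameter (?U w) \<le> ?r" using dist r(1) by (intro diameter_le) auto
        have "?U w \<subseteq> {0..1}" using expand_bounds[of _ 0] by auto
        then show "bounded (?U w)" by (rule bounded_subset[OF bounded_closed_interval])
      qed
      have "B J \<subseteq> (\<Union>w\<in>?I. ?U w)"
      proof
        fix y assume "y \<in> B J"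
        then obtain x where x: "y = expand x" "\<forall>i. x i \<in> D" "\<forall>j\<ge>J. \<not> run j x" by (auto simp: B_def)
        let ?w = "\<lambda>i. if i < n then x i else z"
        have "?w \<in> words n {} (\<lambda>_. z)" by (rule wordsI) (use x in auto)
        moreover have "\<not> run j ?w" if "j \<in> F" for j
        proof -
          have "\<not> run j x" using x(3) F(2) that by blast
          then obtain i where i: "i \<in> {M j..<M j + s j}" "x i \<noteq> z" by (auto simp: run_def)
          then have "?w i \<noteq> z" using nF[OF that] by auto
          then show ?thesis using i(1) unfolding run_def by blast
        qed
        moreover have "y \<in> ?U ?w" using x by (auto simp: agree_def)
        ultimately show "y \<in> (\<Union>w\<in>?I. ?U w)" by blast
      qed
      then have "hausdorff_pre f \<delta> (B J) \<le> ennreal (real (card ?I) * f ?r)"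
        by (intro hausdorff_pre_finite[OF f, where U = ?U]) (use U r in auto)
      also have "real (card ?I) * f ?r \<le> e"
      proof -
        have "?r powr \<gamma> = 1 / q ^ n" by (rule powr_level[OF \<gamma>])
        then have "f ?r \<le> C / q ^ n" using fle(2)[of ?r] r by simp
        then have "real (card ?I) * f ?r \<le> real (card ?I) * (C / q ^ n)"
          by (intro mult_left_mono) auto
        also have "real (card ?I) \<le> 4 * q ^ n / T"
        proof -
          have "real (card ?I) * T \<le> real (card ?I) * (\<Sum>j\<in>F. 1 / q ^ s j)"
            using F(3) by (intro mult_left_mono) auto
          also have "\<dots> \<le> 4 * q ^ n" by (rule card_no_run_le[OF F(1) nF])
          finally show ?thesis using T0 by (simp add: field_simps)
        qed
        then have "real (card ?I) * (C / q ^ n) \<le> 4 * q ^ n / T * (C / q ^ n)"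
          using C0 q0 by (intro mult_right_mono) auto
        also have "\<dots> = e" using C0 e q0 by (simp add: T_def)
        finally show ?thesis .
      qed
      finally show "hausdorff_pre f \<delta> (B J) \<le> 0 + ennreal e" by (simp add: ennreal_leI)
    qed
    then show ?thesis by simp
  qed
  then have null: "hausdorff_f_measure f (\<Union>J. B J) = 0" by (rule hausdorff_f_measure_null_UN)
  have sub: "expand ` {x. (\<forall>i. x i \<in> D) \<and> finite {j. run j x}} \<subseteq> (\<Union>J. B J)"
  proof
    fix y assume "y \<in> expand ` {x. (\<forall>i. x i \<in> D) \<and> finite {j. run j x}}"
    then obtain x where x: "y = expand x" "\<forall>i. x i \<in> D" "finite {j. run j x}" by auto
    then obtain J where "{j. run j x} \<subseteq> {..<J}" unfolding finite_nat_iff_bounded by blast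
    then have "\<not> run j x" if "J \<le> j" for j using that by (auto simp: subset_iff)
    then have "y \<in> B J" using x(1,2) unfolding B_def by blast
    then show "y \<in> (\<Union>J. B J)" by blast
  qed
  show ?thesis using hausdorff_f_measure_mono[OF sub, of f] null by simp
qed

text \<open>Finite measure would give covers of bounded gauge sum at every scale. Trading each
  covering set for five cylinders of comparable gauge keeps the sum bounded, whereas q^a * h a is
  unbounded; at a fine enough scale some point with infinitely many runs escapes.\<close>

lemma many_runs_infinite:
  assumes f: "dimension_function f" and \<gamma>: "real b powr \<gamma> = q"
    and anti: "antimono_on {0<..} (\<lambda>r. r powr (-\<gamma>) * f r)"
    and unb: "\<And>B. \<exists>r>0. B < r powr (-\<gamma>) * f r"
    and div: "\<not> summable (\<lambda>j. q ^ M j * f (1 / real b ^ (M j + s j)))"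
  shows "hausdorff_f_measure f (expand ` {x. (\<forall>i. x i \<in> D) \<and> infinite {j. run j x}}) = \<infinity>"
proof (rule ccontr)
  let ?A = "expand ` {x. (\<forall>i. x i \<in> D) \<and> infinite {j. run j x}}"
  assume "hausdorff_f_measure f ?A \<noteq> \<infinity>"
  then obtain K where K: "hausdorff_f_measure f ?A = ennreal K" "0 \<le> K"
    by (cases "hausdorff_f_measure f ?A") auto
  define h where "h n = f (1 / real b ^ n)" for n
  have q0: "0 < q" using q_ge2 by simp
  have bn0: "0 < 1 / real b ^ n" for n using b_pos by simp
  have bn_anti: "1 / real b ^ m \<le> 1 / real b ^ n" if "n \<le> m" for n m
    using that b_ge2 by (intro divide_left_mono power_increasing) auto
  have h_pos: "0 < h n" for n unfolding h_def by (rule dimension_functionD(1)[OF f bn0])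
  have h_anti: "h m \<le> h n" if "n \<le> m" for n m
    unfolding h_def by (rule dimension_functionD(2)[OF f bn0 bn_anti[OF that]])
  have g_eq: "q ^ n * h n = (1 / real b ^ n) powr (-\<gamma>) * f (1 / real b ^ n)" for n
  proof -
    have "(1 / real b ^ n) powr (-\<gamma>) = q ^ n"
      by (simp add: powr_minus powr_level(2)[OF \<gamma>])
    then show ?thesis by (simp add: h_def)
  qed
  have g_le: "r powr (-\<gamma>) * f r \<le> q ^ n * h n" if "1 / real b ^ n \<le> r" for n r
  proof -
    have "0 < r" using bn0[of n] that by linarith
    then have "1 / real b ^ n \<in> {0<..}" "r \<in> {0<..}" using bn0[of n] by auto
    from monotone_onD[OF anti this that] show ?thesis unfolding g_eq .
  qed
  have g_mono: "q ^ n * h n \<le> q ^ m * h m" if "n \<le> m" for n m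
    using g_le[OF bn_anti[OF that]] unfolding g_eq[of n] .
  have small: "\<exists>n0. \<forall>n\<ge>n0. 1 / real b ^ n < r" if "0 < r" for r
    using order_tendstoD(2)[OF pow_to_zero that] by (simp add: eventually_sequentially)
  have g_unb: "\<exists>n. B < q ^ n * h n" for B
  proof -
    obtain r where r: "0 < r" "B < r powr (-\<gamma>) * f r" using unb by blast
    then obtain n where "1 / real b ^ n < r" using small[of r] by blast
    then have "B < q ^ n * h n" by (rule less_le_trans[OF r(2) g_le[OF less_imp_le]])
    then show ?thesis by blast
  qed
  have h_Suc: "h n \<le> q * h (Suc n)" for n
    using g_mono[of n "Suc n"] q0 by (simp add: mult_ac)
  have h_lim: "h \<longlonglongrightarrow> 0"
  proof -
    have "filterlim (\<lambda>n. 1 / real b ^ n) (at_right 0) sequentially"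
      by (rule tendsto_imp_filterlim_at_right[OF pow_to_zero]) (use bn0 in simp)
    then show ?thesis unfolding h_def by (rule filterlim_compose[OF dimension_functionD(3)[OF f]])
  qed
  \<comment> \<open>Five cylinders per covering set, a factor \<open>q\<close> for rounding its
    diameter up to a power of 1 / b, and 1 for the sum of the allowances (1/2)^(i+1). The value is
    independent of \<open>a\<close>, which is chosen afterwards.\<close>
  define K' where "K' = 5 * (q * (K + 1) + 1)"
  have K'0: "1 \<le> K'" using K(2) q_ge2 by (simp add: K'_def)
  obtain a where a: "10 * K' + 1 < q ^ a * h a" using g_unb by blast
  \<comment> \<open>The exponent is \<open>Suc a\<close> because the cylinders used are one level
    coarser than the first level below the diameter and must still be longer than
    \<open>a\<close>.\<close>
  define \<delta> where "\<delta> = 1 / real b ^ Suc a"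
  have "hausdorff_pre f \<delta> ?A \<le> ennreal K"
    using hausdorff_pre_le_measure[of \<delta> f ?A] K(1) bn0[of "Suc a"] by (simp add: \<delta>_def)
  also have "\<dots> < ennreal (K + 1)" using K(2) by (intro ennreal_lessI) auto
  finally obtain U where U: "?A \<subseteq> (\<Union>i. U i)" "\<And>i. bounded (U i)" "\<And>i. diameter (U i) \<le> \<delta>"
    "(\<Sum>i. gauge_val f (U i)) < ennreal (K + 1)"
    unfolding hausdorff_pre_def INF_less_iff by auto
  define g where "g i = (if diameter (U i) = 0 then 0 else f (diameter (U i)))" for i
  have diam0: "0 \<le> diameter (U i)" for i by (rule diameter_ge_0[OF U(2)])
  have g0: "0 \<le> g i" for i
    using diam0[of i] dimension_functionD(1)[OF f, of "diameter (U i)"] by (auto simp: g_def less_imp_le)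
  have gauge: "gauge_val f (U i) = ennreal (g i)" for i by (simp add: gauge_val_def g_def)
  have g_sums: "summable g" "(\<Sum>i. g i) \<le> K + 1"
  proof -
    have top: "(\<Sum>i. ennreal (g i)) \<noteq> top" using U(4) unfolding gauge by auto
    show sg: "summable g" by (rule summable_suminf_not_top[OF g0 top])
    have "ennreal (\<Sum>i. g i) < ennreal (K + 1)"
      using U(4) unfolding gauge suminf_ennreal2[OF g0 sg] .
    then show "(\<Sum>i. g i) \<le> K + 1"
      unfolding ennreal_less_iff[OF suminf_nonneg[OF sg g0]] by (rule less_imp_le)
  qed
  have "\<exists>n>a. diameter (U i) \<le> 1 / real b ^ n \<and> h n \<le> q * g i + (1/2) ^ Suc i" for i
  proof (cases "diameter (U i) = 0")
    case True
    \<comment> \<open>A set of diameter 0 has gauge 0 but its cylinders do not; a deep level keeps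
      their gauge within the allowance.\<close>
    have "eventually (\<lambda>n. h n < (1/2) ^ Suc i) sequentially"
      by (rule order_tendstoD(2)[OF h_lim]) simp
    then obtain n0 where "\<And>n. n \<ge> n0 \<Longrightarrow> h n < (1/2) ^ Suc i" by (auto simp: eventually_sequentially)
    then have "h (n0 + Suc a) < (1/2) ^ Suc i" by simp
    then show ?thesis using True bn0[of "n0 + Suc a"] g0[of i] q0
      by (intro exI[of _ "n0 + Suc a"]) (auto simp: g_def)
  next
    case False
    then have pos: "0 < diameter (U i)" using diam0[of i] by simp
    define n where "n = (LEAST n. 1 / real b ^ n < diameter (U i))"
    obtain n0 where n0: "1 / real b ^ n0 < diameter (U i)" using small[OF pos] by blast
    have n: "1 / real b ^ n < diameter (U i)" unfolding n_def using n0 by (rule LeastI)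
    have "Suc a < n"
    proof (rule ccontr)
      assume "\<not> Suc a < n"
      then have "\<delta> \<le> 1 / real b ^ n" unfolding \<delta>_def by (intro bn_anti) simp
      then show False using n U(3)[of i] by simp
    qed
    then obtain m where m: "n = Suc m" "a < m" by (cases n) auto
    have "diameter (U i) \<le> 1 / real b ^ m"
      using not_less_Least[of m "\<lambda>n. 1 / real b ^ n < diameter (U i)"] m(1)
      unfolding n_def by simp
    moreover have "h m \<le> q * g i + (1/2) ^ Suc i"
    proof -
      have "h n \<le> g i" unfolding h_def g_def using n False bn0[of n]
        by (auto intro!: dimension_functionD(2)[OF f])
      then have "q * h n \<le> q * g i" using q0 by (intro mult_left_mono) auto
      moreover have "0 \<le> (1/2::real) ^ Suc i" by simp
      ultimately show ?thesis using h_Suc[of m, folded m(1)] by linarith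
    qed
    ultimately show ?thesis using m(2) by blast
  qed
  then obtain N where N: "\<And>i. a < N i" "\<And>i. diameter (U i) \<le> 1 / real b ^ N i"
    "\<And>i. h (N i) \<le> q * g i + (1/2) ^ Suc i" by metis
  have "\<exists>c. \<forall>x. (\<forall>i. x i \<in> D) \<and> expand x \<in> U i \<longrightarrow> (\<exists>k<5::nat. agree (N i) (c k) x)" for i
    using five_cylinders[OF U(2) N(2), of i] by blast
  then obtain c where c: "\<And>i x. (\<forall>i. x i \<in> D) \<Longrightarrow> expand x \<in> U i \<Longrightarrow>
      \<exists>k<5::nat. agree (N i) (c i k) x" by metis
  define N' where "N' i = N (i div 5)" for i
  define c' where "c' i = c (i div 5) (i mod 5)" for i
  have part: "(\<Sum>i<n. h (N' i)) \<le> K'" for n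
  proof -
    have "(\<Sum>i<n. h (N' i)) \<le> (\<Sum>i<n * 5. h (N' i))"
      using h_pos by (intro sum_mono2) (auto simp: less_imp_le)
    also have "\<dots> = (\<Sum>m<n. \<Sum>i\<in>{m * 5..<m * 5 + 5}. h (N' i))"
      by (rule sum.nat_group[symmetric])
    also have "\<dots> = (\<Sum>m<n. 5 * h (N m))"
    proof (rule sum.cong[OF refl])
      fix m
      have "N' i = N m" if "i \<in> {m * 5..<m * 5 + 5}" for i
      proof -
        have "i div 5 = m" using that by auto
        then show ?thesis by (simp add: N'_def)
      qed
      then show "(\<Sum>i\<in>{m * 5..<m * 5 + 5}. h (N' i)) = 5 * h (N m)" by simp
    qed
    also have "\<dots> \<le> (\<Sum>m<n. 5 * (q * g m + (1/2) ^ Suc m))"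
      using N(3) by (intro sum_mono mult_left_mono) auto
    also have "\<dots> = 5 * (q * (\<Sum>m<n. g m) + (\<Sum>m<n. (1/2) ^ Suc m))"
      by (simp only: sum_distrib_left[symmetric] sum.distrib)
    also have "\<dots> \<le> 5 * (q * (K + 1) + 1)"
    proof -
      have "(\<Sum>m<n. g m) \<le> K + 1"
        using sum_le_suminf[OF g_sums(1), of "{..<n}"] g0 g_sums(2) by fastforce
      moreover have "(\<Sum>m<n. (1/2::real) ^ Suc m) \<le> 1"
        using sum_le_suminf[OF sums_summable[OF power_half_series], of "{..<n}"]
          sums_unique[OF power_half_series] by simp
      ultimately show ?thesis using q0 by (intro mult_left_mono add_mono) auto
    qed
    finally show ?thesis by (simp add: K'_def)
  qed
  have N'_sum: "summable (\<lambda>i. h (N' i))"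
    by (rule summableI_nonneg_bounded[OF _ part]) (use h_pos in \<open>auto simp: less_imp_le\<close>)
  have "(\<Sum>i. h (N' i)) \<le> K'" by (rule suminf_le_const[OF N'_sum part])
  then have N'_small: "(\<Sum>i. h (N' i)) < q ^ a * h a / 10" using a by linarith
  have ga: "1 \<le> q ^ a * h a" using a K'0 by linarith
  obtain x where x: "\<forall>i. x i \<in> D" "infinite {j. run j x}" "\<forall>i. \<not> agree (N' i) (c' i) x"
    by (rule run_avoiding_uncapped[of h N' a c', OF h_pos h_anti g_mono g_unb h_lim _ N'_sum _ N'_small ga])
      (use div N(1) in \<open>auto simp: h_def N'_def\<close>)
  then obtain i where "expand x \<in> U i" using U(1) by blast
  then obtain k where "k < 5" "agree (N i) (c i k) x" using c x(1) by blast
  then have "agree (N' (i * 5 + k)) (c' (i * 5 + k)) x" by (simp add: N'_def c'_def)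
  then show False using x(3) by blast
qed

end

section \<open>Approximation by fractions\<close>

lemma nonsummable_residue:
  fixes a :: "nat \<Rightarrow> real"
  assumes a: "\<And>n. 0 \<le> a n" "\<not> summable a" and k: "0 < k"
  shows "\<exists>r<k. \<not> summable (\<lambda>j. a (k * j + r))"
proof (rule ccontr)
  assume "\<not> ?thesis"
  then have sm: "summable (\<lambda>j. a (k * j + r))" if "r < k" for r using that by blast
  have "(\<Sum>i<n. a i) \<le> (\<Sum>r<k. \<Sum>j. a (k * j + r))" for n
  proof -
    have "(\<Sum>i<n. a i) \<le> (\<Sum>i<n * k. a i)"
      using a(1) k by (intro sum_mono2) auto
    also have "\<dots> = (\<Sum>m<n. \<Sum>i\<in>{m * k..<m * k + k}. a i)"
      by (rule sum.nat_group[symmetric])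
    also have "\<dots> = (\<Sum>m<n. \<Sum>r<k. a (k * m + r))"
    proof (rule sum.cong[OF refl])
      fix m
      show "(\<Sum>i\<in>{m * k..<m * k + k}. a i) = (\<Sum>r<k. a (k * m + r))"
        using sum.shift_bounds_nat_ivl[of a 0 "m * k" k]
        by (simp add: atLeast0LessThan add.commute mult.commute)
    qed
    also have "\<dots> = (\<Sum>r<k. \<Sum>m<n. a (k * m + r))" by (rule sum.swap)
    also have "\<dots> \<le> (\<Sum>r<k. \<Sum>j. a (k * j + r))"
      using a(1) by (intro sum_mono sum_le_suminf sm) auto
    finally show ?thesis .
  qed
  then show False using summableI_nonneg_bounded[of a] a by blast
qed

text \<open>If \<open>v\<close> were summable, its terms would drop below \<open>c\<close>, leaving
  only the comparison with \<open>u\<close>. The first alternative accommodates indices with an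
  empty run, where no comparison is available.\<close>

lemma nonsummable_dominated:
  fixes u v :: "nat \<Rightarrow> real"
  assumes "\<not> summable u" "\<And>j. 0 \<le> u j" "0 < c"
    and dom: "eventually (\<lambda>j. c \<le> v j \<or> u j \<le> K * v j) sequentially"
  shows "\<not> summable v"
proof
  assume v: "summable v"
  have "eventually (\<lambda>j. v j < c) sequentially"
    by (rule order_tendstoD(2)[OF summable_LIMSEQ_zero[OF v] assms(3)])
  then have "eventually (\<lambda>j. norm (u j) \<le> K * v j) sequentially"
    using dom by eventually_elim (use assms(2) in auto)
  then show False
    using summable_comparison_test_ev[OF _ summable_mult[OF v]] assms(1) by blast
qed

text \<open>For each exponent only finitely many natural numerators come close enough, so infinitely
  many pairs need infinitely many exponents.\<close>

lemma W_set_infinitely_often: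
  assumes "x \<in> W_set t \<psi>" "0 < t"
  shows "\<exists>n\<ge>N. \<exists>p::nat. \<bar>x - real p / real t ^ Suc n\<bar> < \<psi> (Suc n)"
proof (rule ccontr)
  assume c: "\<not> ?thesis"
  let ?S = "{(p :: nat, n :: nat). n \<ge> 1 \<and> \<bar>x - real p / real t ^ n\<bar> < \<psi> n}"
  have "?S \<subseteq> (\<Union>n\<le>N. {..nat \<lceil>(x + \<psi> n) * real t ^ n\<rceil>} \<times> {n})"
  proof (rule subrelI)
    fix p n assume pn: "(p, n) \<in> ?S"
    then obtain m where m: "n = Suc m" by (cases n) auto
    have "\<not> N \<le> m" using c pn unfolding m by auto
    then have "n \<le> N" using m by simp
    have "real p / real t ^ n < x + \<psi> n" using pn by auto
    then have "real p < (x + \<psi> n) * real t ^ n" using assms(2) by (simp add: field_simps)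
    then have "p \<le> nat \<lceil>(x + \<psi> n) * real t ^ n\<rceil>" by linarith
    then show "(p, n) \<in> (\<Union>n\<le>N. {..nat \<lceil>(x + \<psi> n) * real t ^ n\<rceil>} \<times> {n})"
      using \<open>n \<le> N\<close> by auto
  qed
  then have "finite ?S" by (rule finite_subset) auto
  then show False using assms(1) by (simp add: W_set_def)
qed

lemma W_setI:
  assumes "x \<in> {0..1}" "infinite J" "inj n"
    "\<And>j. j \<in> J \<Longrightarrow> 1 \<le> n j \<and> (\<exists>p::nat. \<bar>x - real p / real t ^ n j\<bar> < \<psi> (n j))"
  shows "x \<in> W_set t \<psi>"
proof -
  let ?S = "{(p :: nat, n :: nat). n \<ge> 1 \<and> \<bar>x - real p / real t ^ n\<bar> < \<psi> n}"
  have "n ` J \<subseteq> snd ` ?S" using assms(4) by force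
  moreover have "infinite (n ` J)"
    using assms(2,3) by (simp add: finite_image_iff inj_on_subset)
  ultimately have "infinite ?S" using finite_subset finite_imageI by blast
  then show ?thesis using assms(1) by (simp add: W_set_def)
qed

section \<open>The convergence case\<close>

context cantor_digits
begin

text \<open>A point within \<open>\<epsilon>\<close> of some \<open>p / t\<^sup>n\<close> is within \<open>\<epsilon>\<close> of one of the two such fractions around it,
  however large \<open>\<epsilon>\<close> is. One-sided intervals of length \<open>\<epsilon>\<close> are used because \<open>f (2 * \<epsilon>)\<close> need not be
  comparable to \<open>f \<epsilon>\<close>.\<close>

lemma approximable_cover:
  assumes f: "dimension_function f" and t: "2 \<le> t" "real t ^ n = real b ^ m * real t ^ r"
    and \<epsilon>: "0 < \<epsilon>" "\<epsilon> \<le> \<delta>"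
  shows "hausdorff_pre f \<delta> {x \<in> cantor_set b D. \<exists>p::nat. \<bar>x - real p / real t ^ n\<bar> < \<epsilon>}
    \<le> ennreal (q ^ m * (2 * (real t ^ r + 2)) * f \<epsilon>)"
proof -
  \<comment> \<open>A cylinder of length \<open>m\<close> spans t^r steps of size 1 / t^n. The
    offset t^r + 1 is the upper neighbour of its right endpoint, and the boolean tells on which side
    of the fraction the interval lies.\<close>
  let ?I = "words m {} (\<lambda>_. z) \<times> ({..t ^ r + 1} \<times> (UNIV :: bool set))"
  define y where "y w c = real (prefix m w * t ^ r + c) / real t ^ n" for w c
  let ?U = "\<lambda>(w, c, s). if s then {y w c..y w c + \<epsilon>} else {y w c - \<epsilon>..y w c}"
  have tn: "0 < real t ^ n" using t(1) by simp
  have "{x \<in> cantor_set b D. \<exists>p::nat. \<bar>x - real p / real t ^ n\<bar> < \<epsilon>} \<subseteq> (\<Union>i\<in>?I. ?U i)"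
  proof
    fix x assume "x \<in> {x \<in> cantor_set b D. \<exists>p::nat. \<bar>x - real p / real t ^ n\<bar> < \<epsilon>}"
    then obtain d and p :: nat where d: "x = expand d" "\<forall>i. d i \<in> D"
      and p: "\<bar>x - real p / real t ^ n\<bar> < \<epsilon>" unfolding cantor_set_eq by auto
    let ?w = "\<lambda>i. if i < m then d i else z"
    have w: "?w \<in> words m {} (\<lambda>_. z)" by (rule wordsI) (use d in auto)
    have "agree m ?w d" by (simp add: agree_def)
    then have pw: "prefix m ?w = prefix m d"
      using prefix_eq_iff[of ?w d m] d(2) z_mem by auto
    let ?P = "real (prefix m d * t ^ r)"
    define Y where "Y = x * real t ^ n - ?P"
    have bm: "0 < real b ^ m" using b_pos by simp
    have "real (prefix m d) \<le> x * real b ^ m" "x * real b ^ m \<le> real (prefix m d) + 1"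
      using expand_bounds[of d m] d bm by (simp_all add: field_simps)
    then have "real (prefix m d) * real t ^ r \<le> x * real b ^ m * real t ^ r"
      "x * real b ^ m * real t ^ r \<le> (real (prefix m d) + 1) * real t ^ r"
      by (auto intro!: mult_right_mono)
    then have Y: "0 \<le> Y" "Y \<le> real (t ^ r)" by (simp_all add: Y_def t(2) algebra_simps)
    define c where "c = nat \<lfloor>Y\<rfloor>"
    have c: "real c \<le> Y" "Y < real c + 1" "c \<le> t ^ r"
      using Y by (auto simp: c_def le_nat_floor nat_le_iff floor_le_iff)
    show "x \<in> (\<Union>i\<in>?I. ?U i)"
    proof (cases "real p \<le> x * real t ^ n")
      case True
      then have "real p < real (prefix m d * t ^ r + c) + 1" using c(2) by (simp add: Y_def)
      then have "p \<le> prefix m d * t ^ r + c" by linarith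
      then have "real p / real t ^ n \<le> y ?w c"
        unfolding y_def pw using tn by (intro divide_right_mono of_nat_mono) auto
      moreover have "y ?w c \<le> x" using c(1) tn by (simp add: y_def pw Y_def field_simps)
      ultimately have "x \<in> ?U (?w, c, True)" using p by auto
      moreover have "(?w, c, True) \<in> ?I" using w c(3) by simp
      ultimately show ?thesis by blast
    next
      case False
      then have "real (prefix m d * t ^ r + c) < real p" using c(1) by (simp add: Y_def)
      then have "prefix m d * t ^ r + (c + 1) \<le> p" by linarith
      then have "y ?w (c + 1) \<le> real p / real t ^ n"
        unfolding y_def pw using tn by (intro divide_right_mono of_nat_mono) auto
      moreover have "x \<le> y ?w (c + 1)" using c(2) tn by (simp add: y_def pw Y_def field_simps)
      ultimately have "x \<in> ?U (?w, c + 1, False)" using p by auto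
      moreover have "(?w, c + 1, False) \<in> ?I" using w c(3) by simp
      ultimately show ?thesis by blast
    qed
  qed
  moreover have "bounded (?U i)" "diameter (?U i) \<le> \<epsilon>" for i
    using \<epsilon>(1) by (auto split: prod.splits)
  ultimately have "hausdorff_pre f \<delta> {x \<in> cantor_set b D. \<exists>p::nat. \<bar>x - real p / real t ^ n\<bar> < \<epsilon>}
      \<le> ennreal (real (card ?I) * f \<epsilon>)"
    by (intro hausdorff_pre_finite[OF f, where U = ?U]) (use \<epsilon> in auto)
  also have "real (card ?I) = q ^ m * (2 * (real t ^ r + 2))"
    using card_words[of "{}" m] by (simp add: card_cartesian_product algebra_simps)
  finally show ?thesis .
qed

text \<open>With n = k * j + r and m = l * j, the count q^m equals t^(k * j * \<gamma>), at most
  t^(n * \<gamma>), and t^r is at most t^k. So the covers have gauge sums bounded by a constant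
  times the terms of the series.\<close>

lemma approximable_null:
  assumes f: "dimension_function f" and \<gamma>: "real b powr \<gamma> = q" "0 \<le> \<gamma>"
    and t: "2 \<le> t" "real t ^ k = real b ^ l" "0 < k" and \<psi>: "\<And>n. 0 < \<psi> n"
    and sm: "summable (\<lambda>n. f (\<psi> (Suc n)) * real t powr (real (Suc n) * \<gamma>))"
  shows "hausdorff_f_measure f (W_set t \<psi> \<inter> cantor_set b D) = 0"
proof -
  define a where "a n = f (\<psi> n) * real t powr (real n * \<gamma>)" for n
  define K where "K = 2 * (real t ^ k + 2)"
  define E where "E n = {x \<in> cantor_set b D. \<exists>p::nat. \<bar>x - real p / real t ^ Suc n\<bar> < \<psi> (Suc n)}" for n
  have f\<psi>: "0 < f (\<psi> n)" for n by (rule dimension_functionD(1)[OF f \<psi>])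
  have tpow: "1 \<le> real t powr (real n * \<gamma>)" for n using t(1) \<gamma>(2) by (intro ge_one_powr_ge_zero) auto
  have sma: "summable (\<lambda>n. a (Suc n))" using sm by (simp add: a_def)
  show ?thesis
  proof (rule hausdorff_f_measure_limsup_null[of "\<lambda>n. K * a (Suc n)" f E])
    show "summable (\<lambda>n. K * a (Suc n))" by (rule summable_mult[OF sma])
    show "0 \<le> K * a (Suc n)" for n using f\<psi>[of "Suc n"] by (simp add: K_def a_def)
    fix \<delta> :: real assume \<delta>: "0 < \<delta>"
    have "eventually (\<lambda>n. a (Suc n) < f \<delta>) sequentially"
      by (rule order_tendstoD(2)[OF summable_LIMSEQ_zero[OF sma] dimension_functionD(1)[OF f \<delta>]])
    then show "eventually (\<lambda>n. hausdorff_pre f \<delta> (E n) \<le> ennreal (K * a (Suc n))) sequentially"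
    proof eventually_elim
      case (elim n)
      let ?n = "Suc n"
      let ?j = "?n div k" and ?r = "?n mod k"
      \<comment> \<open>Smallness of \<open>\<psi>\<close> is drawn from the series: its terms
        dominate f(\<psi> n) and fall below f(\<delta>), and \<open>f\<close> is monotone.\<close>
      have "f (\<psi> ?n) * 1 \<le> a ?n"
        unfolding a_def using f\<psi>[of ?n] tpow[of ?n] by (intro mult_left_mono) auto
      then have "f (\<psi> ?n) < f \<delta>" using elim by simp
      then have small: "\<psi> ?n \<le> \<delta>" using dimension_functionD(2)[OF f \<delta>, of "\<psi> ?n"] by force
      have tn: "real t ^ ?n = real b ^ (l * ?j) * real t ^ ?r"
        by (simp only: power_mult t(2)[symmetric] flip: power_add) (simp flip: power_mult power_add)
      have "q ^ (l * ?j) = (real b ^ (l * ?j)) powr \<gamma>" by (rule powr_level(1)[OF \<gamma>(1), symmetric])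
      also have "real b ^ (l * ?j) = real t powr real (k * ?j)"
        using t by (simp add: power_mult powr_realpow del: of_nat_mult)
      also have "\<dots> powr \<gamma> = real t powr (real (k * ?j) * \<gamma>)" by (simp add: powr_powr)
      also have "\<dots> \<le> real t powr (real ?n * \<gamma>)"
      proof -
        have "k * ?j \<le> ?n" by (rule times_div_less_eq_dividend)
        then show ?thesis using t(1) \<gamma>(2) by (intro powr_mono mult_right_mono of_nat_mono) auto
      qed
      finally have q_le: "q ^ (l * ?j) \<le> real t powr (real ?n * \<gamma>)" .
      have r_le: "2 * (real t ^ ?r + 2) \<le> K"
        unfolding K_def using t(1,3) by (intro mult_left_mono add_right_mono power_increasing) auto
      have "hausdorff_pre f \<delta> (E n) \<le> ennreal (q ^ (l * ?j) * (2 * (real t ^ ?r + 2)) * f (\<psi> ?n))"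
        unfolding E_def by (rule approximable_cover[OF f t(1) tn \<psi> small])
      also have "\<dots> \<le> ennreal (real t powr (real ?n * \<gamma>) * K * f (\<psi> ?n))"
        using q_le r_le f\<psi>[of ?n] by (intro ennreal_leI mult_right_mono mult_mono) auto
      also have "\<dots> = ennreal (K * a ?n)" by (simp add: a_def mult_ac)
      finally show ?case .
    qed
  next
    show "\<exists>n\<ge>N. x \<in> E n" if "x \<in> W_set t \<psi> \<inter> cantor_set b D" for x N
      using W_set_infinitely_often[of x t \<psi> N] that t(1) by (auto simp: E_def)
  qed
qed

end

section \<open>Choice of the run lengths and the divergence case\<close>

theorem theorem1p5:
  fixes b t :: nat and D :: "nat set" and f :: "real \<Rightarrow> real" and \<psi> :: "nat \<Rightarrow> real"
    and \<gamma> :: real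
  assumes hb: "b \<ge> 3"
    and hD: "D \<subseteq> {0..<b}" "2 \<le> card D" "card D \<le> b - 1"
    and hD0: "0 \<in> D \<or> b - 1 \<in> D"
    and h\<gamma>: "\<gamma> = ln (real (card D)) / ln (real b)"
    and ht: "t \<ge> 2"
    and hdep: "ln (real t) / ln (real b) \<in> \<rat>"
    and hf: "dimension_function f"
    and hmono: "mono_on {0<..} (\<lambda>r. r powr (-\<gamma>) * f r) \<or>
                antimono_on {0<..} (\<lambda>r. r powr (-\<gamma>) * f r)"
    and h\<psi>: "\<forall>n. \<psi> n > 0"
  shows "(summable (\<lambda>n. f (\<psi> (Suc n)) * real t powr (real (Suc n) * \<gamma>)) \<longrightarrow>
            hausdorff_f_measure f (W_set t \<psi> \<inter> cantor_set b D) = 0) \<and>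
         (\<not> summable (\<lambda>n. f (\<psi> (Suc n)) * real t powr (real (Suc n) * \<gamma>)) \<longrightarrow>
            hausdorff_f_measure f (W_set t \<psi> \<inter> cantor_set b D) =
            hausdorff_f_measure f (cantor_set b D))"
proof -
  obtain z where z: "z \<in> D" "z = 0 \<or> z = b - 1" using hD0 by blast
  interpret cantor_digits D z b
    by unfold_locales (use hb hD z finite_subset[OF hD(1)] in auto)
  have lnb: "0 < ln (real b)" using hb by simp
  have lnt: "0 < ln (real t)" using ht by simp
  have \<gamma>: "real b powr \<gamma> = q" using lnb hb q_ge2 by (simp add: h\<gamma> powr_def)
  have \<gamma>0: "0 \<le> \<gamma>" using lnb q_ge2 by (simp add: h\<gamma>)
  obtain l k :: nat where lk: "k \<noteq> 0" "\<bar>ln (real t) / ln (real b)\<bar> = real l / real k"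
    using Rats_abs_nat_div_natE[OF hdep] by metis
  then have "real l * ln (real b) = real k * ln (real t)" using lnb lnt by (simp add: field_simps)
  then have "ln (real b ^ l) = ln (real t ^ k)" using hb ht by (simp add: ln_realpow)
  then have tk: "real t ^ k = real b ^ l" using hb ht by simp
  have l: "0 < l" using lk lnb lnt by (cases l) auto
  have k: "0 < k" using lk by simp
  let ?W = "W_set t \<psi> \<inter> cantor_set b D"
  have "hausdorff_f_measure f ?W = 0"
    if "summable (\<lambda>n. f (\<psi> (Suc n)) * real t powr (real (Suc n) * \<gamma>))"
    using approximable_null[OF hf \<gamma> \<gamma>0 ht tk k _ that] h\<psi> by blast
  moreover have "hausdorff_f_measure f ?W = hausdorff_f_measure f (cantor_set b D)"
    if div: "\<not> summable (\<lambda>n. f (\<psi> (Suc n)) * real t powr (real (Suc n) * \<gamma>))"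
  proof -
    define a where "a n = f (\<psi> n) * real t powr (real n * \<gamma>)" for n
    have f\<psi>: "0 < f (\<psi> n)" for n using dimension_functionD(1)[OF hf] h\<psi> by blast
    have "\<not> summable a" using div summable_Suc_iff[of a] by (simp add: a_def)
    moreover have "0 \<le> a n" for n using f\<psi>[of n] by (simp add: a_def)
    ultimately obtain r where r: "\<not> summable (\<lambda>j. a (k * j + r))"
      using nonsummable_residue[of a k] k by blast
    \<comment> \<open>This is a (k * j + r) without the constant factor t^(r * \<gamma>), since q^(l
      * j) = t^(k * j * \<gamma>).\<close>
    define u where "u j = q ^ (l * j) * f (\<psi> (k * j + r))" for j
    have "a (k * j + r) = real t powr (real r * \<gamma>) * u j" for j
    proof -
      have "q ^ (l * j) = (real t ^ (k * j)) powr \<gamma>"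
        using powr_level(1)[OF \<gamma>, of "l * j"] by (simp add: power_mult tk)
      also have "\<dots> = real t powr (real (k * j) * \<gamma>)"
        using ht by (simp add: powr_realpow[symmetric] powr_powr del: of_nat_mult)
      finally show ?thesis by (simp add: a_def u_def distrib_right powr_add)
    qed
    then have u_div: "\<not> summable u" using r summable_mult[of u] by auto
    have u0: "0 \<le> u j" for j using f\<psi>[of "k * j + r"] by (simp add: u_def)
    \<comment> \<open>The shortest run that guarantees the approximation. By minimality, one digit
      less gives at least \<psi>, so the two scales are comparable unless \<open>s j\<close> is
      0.\<close>
    define s where "s j = (LEAST s. 1 / real b ^ (l * j + s) < \<psi> (k * j + r))" for j
    interpret cantor_runs D z b "\<lambda>j. l * j" s
      by unfold_locales (use l in \<open>simp add: strict_mono_def\<close>)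
    have ex_s: "\<exists>s. 1 / real b ^ (l * j + s) < \<psi> (k * j + r)" for j
    proof -
      have "eventually (\<lambda>n. 1 / real b ^ n < \<psi> (k * j + r)) sequentially"
        using h\<psi> by (intro order_tendstoD(2)[OF pow_to_zero]) blast
      then obtain n0 where "\<And>n. n \<ge> n0 \<Longrightarrow> 1 / real b ^ n < \<psi> (k * j + r)"
        by (auto simp: eventually_sequentially)
      then show ?thesis by (intro exI[of _ n0]) simp
    qed
    have s: "1 / real b ^ (l * j + s j) < \<psi> (k * j + r)" for j
      unfolding s_def by (rule LeastI_ex[OF ex_s])
    have s_Suc: "\<psi> (k * j + r) \<le> 1 / real b ^ (l * j + v)" if "s j = Suc v" for j v
      using not_less_Least[of v "\<lambda>s. 1 / real b ^ (l * j + s) < \<psi> (k * j + r)"] that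
      unfolding s_def by simp
    let ?many = "expand ` {x. (\<forall>i. x i \<in> D) \<and> infinite {j. run j x}}"
    let ?few = "expand ` {x. (\<forall>i. x i \<in> D) \<and> finite {j. run j x}}"
    have many: "?many \<subseteq> ?W"
    proof
      fix y assume "y \<in> ?many"
      then obtain x where x: "y = expand x" "\<forall>i. x i \<in> D" "infinite {j. run j x}" by auto
      have yC: "y \<in> cantor_set b D" unfolding cantor_set_eq using x by blast
      have "y \<in> W_set t \<psi>"
      \<comment> \<open>Index 0 is removed because \<open>r\<close> may be 0, while exponents in
        \<open>W_set\<close> start at 1.\<close>
      proof (rule W_setI[of y "{j. run j x} - {0}" "\<lambda>j. k * j + r"])
        show "y \<in> {0..1}" using yC by (simp add: cantor_set_def)
        show "infinite ({j. run j x} - {0})" using x(3) by simp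
        show "inj (\<lambda>j. k * j + r)" using k by (simp add: inj_def)
        fix j assume j: "j \<in> {j. run j x} - {0}"
        obtain p :: nat where p: "\<bar>expand x - real p / real b ^ (l * j)\<bar> \<le> 1 / real b ^ (l * j + s j)"
          using expand_near_endpoint[of x "l * j" "l * j + s j"] x(2) j by (auto simp: run_def)
        have "real p / real b ^ (l * j) = real (p * t ^ r) / real t ^ (k * j + r)"
          using ht by (simp add: power_add power_mult tk)
        then have "\<bar>y - real (p * t ^ r) / real t ^ (k * j + r)\<bar> < \<psi> (k * j + r)"
          using p s[of j] x(1) by simp
        then show "1 \<le> k * j + r \<and> (\<exists>p::nat. \<bar>y - real p / real t ^ (k * j + r)\<bar> < \<psi> (k * j + r))"
          using j k by (intro conjI exI[of _ "p * t ^ r"]) (auto simp: Suc_le_eq)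
      qed
      then show "y \<in> ?W" using yC by simp
    qed
    have W_le: "hausdorff_f_measure f ?W \<le> hausdorff_f_measure f (cantor_set b D)"
      by (rule hausdorff_f_measure_mono) simp
    show ?thesis
    proof (cases "\<exists>C r0. 0 < r0 \<and> (\<forall>r. 0 < r \<and> r \<le> r0 \<longrightarrow> f r \<le> C * r powr \<gamma>)")
      case True
      then obtain C r0 where C: "0 < r0" "\<And>r. 0 < r \<Longrightarrow> r \<le> r0 \<Longrightarrow> f r \<le> C * r powr \<gamma>" by blast
      have "eventually (\<lambda>n. 1 / real b ^ n < r0) sequentially"
        by (rule order_tendstoD(2)[OF pow_to_zero C(1)])
      then obtain n0 where n0: "\<And>n. n \<ge> n0 \<Longrightarrow> 1 / real b ^ n < r0"
        by (auto simp: eventually_sequentially)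
      have "0 < C * r0 powr \<gamma>" using C(2)[of r0] C(1) dimension_functionD(1)[OF hf C(1)] by simp
      then have C0: "0 \<le> C" using C(1) by (simp add: zero_less_mult_iff)
      \<comment> \<open>An empty run gives the first alternative. Otherwise \<psi> is at most b^(-(l
        * j + s j - 1)), and the missing digit costs the factor \<open>q\<close>.\<close>
      have "1 \<le> 1 / q ^ s j \<or> u j \<le> (C * q) * (1 / q ^ s j)" if j: "n0 \<le> j" for j
      proof (cases "s j")
        case (Suc v)
        let ?m = "l * j + v"
        have "n0 \<le> ?m" using j l by (metis le_add1 le_trans mult_le_mono1 mult_1 Suc_leI One_nat_def)
        then have "\<psi> (k * j + r) \<le> r0" using s_Suc[OF Suc] n0[of ?m] by simp
        then have "f (\<psi> (k * j + r)) \<le> C * \<psi> (k * j + r) powr \<gamma>" using C(2) h\<psi> by blast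
        also have "\<dots> \<le> C * (1 / real b ^ ?m) powr \<gamma>"
          using s_Suc[OF Suc] h\<psi> C0 \<gamma>0 by (intro mult_left_mono powr_mono2) (auto simp: less_imp_le)
        also have "\<dots> = C / q ^ ?m" by (simp add: powr_level(2)[OF \<gamma>])
        finally have "u j \<le> q ^ (l * j) * (C / q ^ ?m)" unfolding u_def by (intro mult_left_mono) auto
        also have "\<dots> = (C * q) * (1 / q ^ s j)" using q_ge2 Suc by (simp add: power_add)
        finally show ?thesis by blast
      qed simp
      then have "eventually (\<lambda>j. 1 \<le> 1 / q ^ s j \<or> u j \<le> (C * q) * (1 / q ^ s j)) sequentially"
        unfolding eventually_sequentially by blast
      then have s_div: "\<not> summable (\<lambda>j. 1 / q ^ s j)"
        by (rule nonsummable_dominated[OF u_div u0 zero_less_one])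
      have few: "hausdorff_f_measure f ?few = 0"
        by (rule few_runs_null[OF hf \<gamma> C(1) _ s_div]) (rule C(2))
      have "cantor_set b D \<subseteq> ?W \<union> ?few" using many unfolding cantor_set_eq by blast
      then have "hausdorff_f_measure f (cantor_set b D) \<le> hausdorff_f_measure f (?W \<union> ?few)"
        by (rule hausdorff_f_measure_mono)
      also have "\<dots> \<le> hausdorff_f_measure f ?W" by (rule hausdorff_f_measure_Un_null[OF few])
      finally show ?thesis using W_le by (rule antisym[rotated])
    next
      case False
      have expand_f: "f r = (r powr (-\<gamma>) * f r) * r powr \<gamma>" if "0 < r" for r
        using that by (simp add: powr_minus)
      \<comment> \<open>A non-decreasing quotient would be at most \<open>f 1\<close> on (0,1],
        which is the case already settled.\<close>
      have anti: "antimono_on {0<..} (\<lambda>r. r powr (-\<gamma>) * f r)"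
      proof (rule ccontr)
        assume "\<not> ?thesis"
        then have mono: "mono_on {0<..} (\<lambda>r. r powr (-\<gamma>) * f r)" using hmono by blast
        have "f r \<le> f 1 * r powr \<gamma>" if "0 < r" "r \<le> 1" for r
        proof -
          have "r powr (-\<gamma>) * f r \<le> 1 powr (-\<gamma>) * f 1"
            using monotone_onD[OF mono, of r 1] that by simp
          then show ?thesis
            by (subst expand_f[OF that(1)]) (intro mult_right_mono, auto)
        qed
        then show False using False zero_less_one by blast
      qed
      have unb: "\<exists>r>0. B < r powr (-\<gamma>) * f r" for B
      proof (rule ccontr)
        assume "\<not> ?thesis"
        then have "r powr (-\<gamma>) * f r \<le> B" if "0 < r" for r using that by force
        then have "f r \<le> B * r powr \<gamma>" if "0 < r" for r
          by (subst expand_f[OF that]) (intro mult_right_mono, use that in auto)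
        then show False using False zero_less_one by blast
      qed
      let ?v = "\<lambda>j. q ^ (l * j) * f (1 / real b ^ (l * j + s j))"
      have level: "q ^ n * f (1 / real b ^ n) = (1 / real b ^ n) powr (-\<gamma>) * f (1 / real b ^ n)" for n
        by (simp add: powr_minus powr_level(2)[OF \<gamma>])
      have level_mono: "q ^ n * f (1 / real b ^ n) \<le> q ^ m * f (1 / real b ^ m)" if "n \<le> m" for n m
      proof -
        have "1 / real b ^ m \<le> 1 / real b ^ n"
          using that hb by (intro divide_left_mono power_increasing) auto
        moreover have "1 / real b ^ m \<in> {0<..}" "1 / real b ^ n \<in> {0<..}" using hb by auto
        ultimately show ?thesis unfolding level using monotone_onD[OF anti] by blast
      qed
      \<comment> \<open>For an empty run, \<open>?v j\<close> is at least its value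
        \<open>f 1\<close> at level 0; otherwise passing from \<psi> to the run's scale loses at
        most one level, that is a factor \<open>q\<close>.\<close>
      have "f 1 \<le> ?v j \<or> u j \<le> q * ?v j" for j
      proof (cases "s j")
        case 0
        then show ?thesis using level_mono[of 0 "l * j"] by simp
      next
        case (Suc v)
        let ?m = "l * j + v"
        have "q ^ ?m * f (1 / real b ^ ?m) \<le> q ^ Suc ?m * f (1 / real b ^ Suc ?m)"
          by (rule level_mono) simp
        then have "f (1 / real b ^ ?m) \<le> q * f (1 / real b ^ Suc ?m)"
          using q_ge2 by (simp add: mult_ac)
        moreover have "f (\<psi> (k * j + r)) \<le> f (1 / real b ^ ?m)"
          using dimension_functionD(2)[OF hf _ s_Suc[OF Suc]] h\<psi> by blast
        ultimately have "f (\<psi> (k * j + r)) \<le> q * f (1 / real b ^ (l * j + s j))"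
          using Suc by simp
        then have "u j \<le> q ^ (l * j) * (q * f (1 / real b ^ (l * j + s j)))"
          unfolding u_def by (intro mult_left_mono) auto
        then show ?thesis by (simp add: mult_ac)
      qed
      then have "eventually (\<lambda>j. f 1 \<le> ?v j \<or> u j \<le> q * ?v j) sequentially" by simp
      then have "\<not> summable ?v"
        by (rule nonsummable_dominated[OF u_div u0 dimension_functionD(1)[OF hf zero_less_one]])
      then have "hausdorff_f_measure f ?many = \<infinity>"
        by (rule many_runs_infinite[OF hf \<gamma> anti unb])
      then have "hausdorff_f_measure f ?W = \<infinity>"
        using hausdorff_f_measure_mono[OF many, of f] by (simp add: top_unique)
      then show ?thesis using W_le by (simp add: top_unique)
    qed
  qed
  ultimately show ?thesis by blast
qed

end
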